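(* For the Range Subgraph Counting problem with pattern $Q=$ $\ell$-clique (for a constant $\ell$), there is a data structure of $O(m)$ space answering a query in $\tilde{O}(1)$ time.
   Context: Range Subgraph Counting: $G=(V,E)$ is an undirected graph with $m=|E|$ edges, each vertex $v$ carrying a real-valued attribute $A_v$. For an interval $q=[x_1,x_2]$, $G_q$ is the subgraph of $G$ induced by $\{v\in V\mid x_1\le A_v\le x_2\}$. A query, given $q$, returns the number of occurrences (subgraphs isomorphic to $Q$) of the fixed pattern $Q$ in $G_q$. An $\ell$-clique is a complete graph on $\ell$ vertices. $\tilde{O}(\cdot)$ hides polylogarithmic factors.
   Formalization: For ℓ = 1 (counting vertices) the graph is additionally assumed to have no isolated vertices, since otherwise O(m) space is impossible (m = 0 with arbitrarily many vertices); nothing is added for ℓ ≥ 2. *)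

theory Defs
  imports Complex_Main "HOL-Library.Landau_Symbols" "HOL-Library.Ramsey"
begin

section \<open>Graphs, occurrences, range subgraphs\<close>

type_synonym 'a graph = "'a set \<times> 'a set set"

abbreviation verts :: "'a graph \<Rightarrow> 'a set" where "verts \<equiv> fst"
abbreviation edges :: "'a graph \<Rightarrow> 'a set set" where "edges \<equiv> snd"

definition simple_graph :: "'a graph \<Rightarrow> bool" where
  "simple_graph G \<longleftrightarrow> finite (verts G) \<and> edges G \<subseteq> nsets (verts G) 2"

definition num_edges :: "'a graph \<Rightarrow> nat" where
  "num_edges G = card (edges G)"

text \<open>
  Isolated vertices matter only for the one-vertex pattern: counting vertices needs space
  linear in the number of vertices, which \<open>num_edges\<close> bounds only if none is isolated.
\<close>

definition no_isolated :: "'a graph \<Rightarrow> bool" where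
  "no_isolated G \<longleftrightarrow> (\<forall>v\<in>verts G. \<exists>e\<in>edges G. v \<in> e)"

definition subgraph :: "'a graph \<Rightarrow> 'a graph \<Rightarrow> bool" where
  "subgraph H G \<longleftrightarrow> simple_graph H \<and> verts H \<subseteq> verts G \<and> edges H \<subseteq> edges G"

definition induced :: "'a graph \<Rightarrow> 'a set \<Rightarrow> 'a graph" where
  "induced G U = (verts G \<inter> U, {e \<in> edges G. e \<subseteq> U})"

definition isomorphic :: "'a graph \<Rightarrow> 'b graph \<Rightarrow> bool" where
  "isomorphic H Q \<longleftrightarrow> (\<exists>f. bij_betw f (verts H) (verts Q) \<and> (\<lambda>e. f ` e) ` edges H = edges Q)"

definition occurrences :: "'b graph \<Rightarrow> 'a graph \<Rightarrow> 'a graph set" where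
  "occurrences Q G = {H. subgraph H G \<and> isomorphic H Q}"

definition clique_graph :: "nat \<Rightarrow> nat graph" where
  "clique_graph l = ({..<l}, nsets {..<l} 2)"

definition range_subgraph :: "'a graph \<Rightarrow> ('a \<Rightarrow> real) \<Rightarrow> real \<Rightarrow> real \<Rightarrow> 'a graph" where
  "range_subgraph G A x1 x2 = induced G {v \<in> verts G. x1 \<le> A v \<and> A v \<le> x2}"

section \<open>Query programs on a word RAM\<close>

text \<open>
  Words are natural numbers below \<open>2 ^ w\<close>. Real numbers occupy cells and registers of their own
  and can only be copied and compared: with real arithmetic or rounding, a single real could
  encode the whole graph. A query program has finitely many registers and only reads the stored
  structure, so a query leaves the structure intact and uses constant working space. Every
  elementary step (assignment, memory access, comparison, branch) costs one unit.
\<close>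

datatype binop = Add | Sub | Mul | Div | Mod | And | Or | Xor | Shl | Shr | Less | Equal

fun eval_binop :: "nat \<Rightarrow> binop \<Rightarrow> nat \<Rightarrow> nat \<Rightarrow> nat" where
  "eval_binop w Add x y = (x + y) mod 2 ^ w"
| "eval_binop w Sub x y = (x + 2 ^ w - y) mod 2 ^ w"
| "eval_binop w Mul x y = (x * y) mod 2 ^ w"
| "eval_binop w Div x y = x div y"
| "eval_binop w Mod x y = x mod y"
| "eval_binop w And x y = Bit_Operations.and x y"
| "eval_binop w Or x y = Bit_Operations.or x y"
| "eval_binop w Xor x y = Bit_Operations.xor x y"
| "eval_binop w Shl x y = push_bit y x mod 2 ^ w"
| "eval_binop w Shr x y = drop_bit y x"
| "eval_binop w Less x y = of_bool (x < y)"
| "eval_binop w Equal x y = of_bool (x = y)"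

text \<open>
  Registers are numbered. In \<open>LoadReal a i\<close> and \<open>LeReal i a b\<close>, the indices \<open>a\<close>, \<open>b\<close> denote real
  registers and \<open>i\<close> a word register; all other indices denote word registers. A conditional or
  loop tests whether its register is nonzero.
\<close>

datatype com =
    Skip
  | Const nat nat
  | Op nat binop nat nat
  | Load nat nat
  | LoadReal nat nat
  | LeReal nat nat nat
  | Seq com com
  | Cond nat com com
  | While nat com

type_synonym state = "(nat \<Rightarrow> nat) \<times> (nat \<Rightarrow> real)"

text \<open>
  A memory image consists of an array of words and an array of reals. Access outside the
  arrays is stuck: the run then has no result.
\<close>

type_synonym image = "nat list \<times> real list"

definition valid_image :: "nat \<Rightarrow> image \<Rightarrow> bool" where
  "valid_image w D \<longleftrightarrow> (\<forall>x\<in>set (fst D). x < 2 ^ w)"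

definition space :: "image \<Rightarrow> nat" where
  "space D = length (fst D) + length (snd D)"

text \<open>
  \<open>exec w D p s t s'\<close>: with word length \<open>w\<close> and memory image \<open>D\<close>, program \<open>p\<close> started in state \<open>s\<close>
  terminates in state \<open>s'\<close> after \<open>t\<close> steps.
\<close>

inductive exec :: "nat \<Rightarrow> image \<Rightarrow> com \<Rightarrow> state \<Rightarrow> nat \<Rightarrow> state \<Rightarrow> bool"
  for w :: nat and D :: image where
  Skip: "exec w D Skip s 1 s"
| Const: "exec w D (Const i k) (u, r) 1 (u(i := k mod 2 ^ w), r)"
| Op: "exec w D (Op i f j k) (u, r) 1 (u(i := eval_binop w f (u j) (u k)), r)"
| Load: "u j < length (fst D) \<Longrightarrow> exec w D (Load i j) (u, r) 1 (u(i := fst D ! u j), r)"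
| LoadReal: "u i < length (snd D) \<Longrightarrow>
    exec w D (LoadReal a i) (u, r) 1 (u, r(a := snd D ! u i))"
| LeReal: "exec w D (LeReal i a b) (u, r) 1 (u(i := of_bool (r a \<le> r b)), r)"
| Seq: "exec w D p s t s' \<Longrightarrow> exec w D q s' t' s'' \<Longrightarrow> exec w D (Seq p q) s (t + t') s''"
| CondTrue: "u i \<noteq> 0 \<Longrightarrow> exec w D p (u, r) t s' \<Longrightarrow> exec w D (Cond i p q) (u, r) (Suc t) s'"
| CondFalse: "u i = 0 \<Longrightarrow> exec w D q (u, r) t s' \<Longrightarrow> exec w D (Cond i p q) (u, r) (Suc t) s'"
| WhileTrue: "u i \<noteq> 0 \<Longrightarrow> exec w D p (u, r) t s' \<Longrightarrow> exec w D (While i p) s' t' s'' \<Longrightarrow>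
    exec w D (While i p) (u, r) (Suc (t + t')) s''"
| WhileFalse: "u i = 0 \<Longrightarrow> exec w D (While i p) (u, r) 1 (u, r)"

definition query_state :: "real \<Rightarrow> real \<Rightarrow> state" where
  "query_state x1 x2 = ((\<lambda>_. 0), (\<lambda>_. 0)(0 := x1, 1 := x2))"

definition answers :: "nat \<Rightarrow> image \<Rightarrow> com \<Rightarrow> real \<Rightarrow> real \<Rightarrow> nat \<Rightarrow> nat \<Rightarrow> bool" where
  "answers w D p x1 x2 t n \<longleftrightarrow> (\<exists>u r. exec w D p (query_state x1 x2) t (u, r) \<and> u 0 = n)"

end

theory Submission
  imports Defs "HOL-Library.Multiset"
begin

text \<open>
  A clique lies in the range subgraph iff the interval from its least to its greatest attribute
  lies in the query interval, and the interval of a clique with at least two vertices is already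
  that of one of its edges. So there are at most \<open>2 * m\<close> distinct intervals (for single vertices
  this uses that no vertex is isolated), and with the number of cliques at each interval as
  weight, a query is a two-dimensional dominance sum over these intervals.

  Dominance sums are answered by a wavelet matrix: the intervals are sorted by decreasing left
  end, and level \<open>k + 1\<close> is the stable partition of level \<open>k\<close> by one more bit of the rank of the
  right end. Storing all weights on each of the \<open>H = O(log m)\<close> levels would cost a logarithmic
  factor in space. Instead, the \<open>H\<close> bits at a position share one word, ranks and prefix weights
  are sampled only at multiples of \<open>H\<close>, and weights are stored on the last level alone. The
  fewer than \<open>H\<close> weights missing from a sampled prefix sum are found by tracing each of their
  positions down to the last level, which gives \<open>O(H ^ 4)\<close> time.
\<close>

section \<open>Reasoning about query programs\<close>

text \<open>\<open>answers\<close> asks for some terminating run together with its step count, so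
  the precondition is existential as well and the postcondition sees the count.\<close>

definition wp :: "nat \<Rightarrow> image \<Rightarrow> com \<Rightarrow> state \<Rightarrow> (nat \<Rightarrow> state \<Rightarrow> bool) \<Rightarrow> bool" where
  "wp w D p s Q \<longleftrightarrow> (\<exists>t s'. exec w D p s t s' \<and> Q t s')"

inductive_cases exec_ConstE: "exec w D (Const i k) (u, r) t s'"
inductive_cases exec_OpE: "exec w D (Op i f j k) (u, r) t s'"
inductive_cases exec_LoadE: "exec w D (Load i j) (u, r) t s'"
inductive_cases exec_LoadRealE: "exec w D (LoadReal a i) (u, r) t s'"
inductive_cases exec_LeRealE: "exec w D (LeReal i a b) (u, r) t s'"
inductive_cases exec_SkipE: "exec w D Skip s t s'"
inductive_cases exec_SeqE: "exec w D (Seq p q) s t s'"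
inductive_cases exec_CondE: "exec w D (Cond i p q) (u, r) t s'"

lemma wp_Skip: "wp w D Skip s Q \<longleftrightarrow> Q 1 s"
  unfolding wp_def by (metis exec.Skip exec_SkipE One_nat_def)

lemma wp_Const: "wp w D (Const i k) (u, r) Q \<longleftrightarrow> Q 1 (u(i := k mod 2 ^ w), r)"
  unfolding wp_def by (auto simp flip: One_nat_def elim!: exec_ConstE intro!: exI exec.Const)

lemma wp_Op: "wp w D (Op i f j k) (u, r) Q \<longleftrightarrow> Q 1 (u(i := eval_binop w f (u j) (u k)), r)"
  unfolding wp_def by (auto simp flip: One_nat_def elim!: exec_OpE intro!: exI exec.Op)

lemma wp_Load: "wp w D (Load i j) (u, r) Q \<longleftrightarrow>
    u j < length (fst D) \<and> Q 1 (u(i := fst D ! u j), r)"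
  unfolding wp_def by (auto simp flip: One_nat_def elim!: exec_LoadE intro!: exI exec.Load)

lemma wp_LoadReal: "wp w D (LoadReal a i) (u, r) Q \<longleftrightarrow>
    u i < length (snd D) \<and> Q 1 (u, r(a := snd D ! u i))"
  unfolding wp_def by (auto simp flip: One_nat_def elim!: exec_LoadRealE intro!: exI exec.LoadReal)

lemma wp_LeReal: "wp w D (LeReal i a b) (u, r) Q \<longleftrightarrow> Q 1 (u(i := of_bool (r a \<le> r b)), r)"
  unfolding wp_def by (auto simp flip: One_nat_def elim!: exec_LeRealE intro!: exI exec.LeReal)

lemma wp_Seq: "wp w D (Seq p q) s Q \<longleftrightarrow> wp w D p s (\<lambda>t s'. wp w D q s' (\<lambda>t'. Q (t + t')))"
  unfolding wp_def by (blast elim: exec_SeqE intro: exec.Seq)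

lemma wp_Cond: "wp w D (Cond i p q) (u, r) Q \<longleftrightarrow>
    (if u i \<noteq> 0 then wp w D p (u, r) (\<lambda>t. Q (Suc t)) else wp w D q (u, r) (\<lambda>t. Q (Suc t)))"
  unfolding wp_def by (auto split: if_splits elim!: exec_CondE intro: exec.intros)

lemmas wp_simps = wp_Skip wp_Const wp_Op wp_Load wp_LoadReal wp_LeReal wp_Seq wp_Cond

text \<open>The number \<open>n\<close> of rounds is fixed in advance, so termination is an
  induction on the rounds left. Each round pays \<open>B\<close> and one test; the last unit is the
  failing test.\<close>

lemma wp_counted_loop:
  assumes body: "\<And>j u r. j < n \<Longrightarrow> I j u r \<Longrightarrow>
      u c \<noteq> 0 \<and> wp w D p (u, r) (\<lambda>t s'. t \<le> B \<and> I (Suc j) (fst s') (snd s'))"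
    and exit: "\<And>u r. I n u r \<Longrightarrow> u c = 0"
    and init: "I 0 u r"
    and post: "\<And>t u' r'. t \<le> n * Suc B + 1 \<Longrightarrow> I n u' r' \<Longrightarrow> Q t (u', r')"
  shows "wp w D (While c p) (u, r) Q"
proof -
  have "\<exists>t u' r'. exec w D (While c p) (u, r) t (u', r') \<and> t \<le> (n - j) * Suc B + 1 \<and> I n u' r'"
    if "j \<le> n" "I j u r" for j u r
    using that
  proof (induction "n - j" arbitrary: j u r)
    case 0
    then show ?case
      using exit by (auto intro!: exI exec.WhileFalse)
  next
    case (Suc d)
    then have "j < n" by simp
    with body[OF this Suc.prems(2)] obtain t u1 r1 where
      1: "u c \<noteq> 0" "exec w D p (u, r) t (u1, r1)" "t \<le> B" "I (Suc j) u1 r1"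
      unfolding wp_def by auto
    obtain t' u' r' where
      2: "exec w D (While c p) (u1, r1) t' (u', r')" "t' \<le> (n - Suc j) * Suc B + 1" "I n u' r'"
      using Suc.hyps(1)[OF _ _ 1(4)] Suc.hyps(2) \<open>j < n\<close> by fastforce
    have "n - j = Suc (n - Suc j)" using \<open>j < n\<close> by simp
    then have "Suc (t + t') \<le> (n - j) * Suc B + 1"
      using 1(3) 2(2) by simp
    then show ?case
      using exec.WhileTrue[of u c w D p r t "(u1, r1)" t' "(u', r')"] 1 2 by blast
  qed
  from this[of 0 u r] init post show ?thesis
    unfolding wp_def by fastforce
qed

fun seqs :: "com list \<Rightarrow> com" where
  "seqs [] = Skip"
| "seqs [p] = p"
| "seqs (p # q # ps) = Seq p (seqs (q # ps))"

abbreviation Move :: "nat \<Rightarrow> nat \<Rightarrow> com" where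
  "Move i j \<equiv> Op i Or j j"

text \<open>Words wrap around; these equations give exact arithmetic under bounds that exclude
  overflow. They stand in for the defining equations of \<open>eval_binop\<close>, which are then
  removed from the simpset.\<close>

lemma eval_Add: "x + y < 2 ^ w \<Longrightarrow> eval_binop w Add x y = x + y"
  by (simp add: eval_binop.simps)

lemma eval_Sub: "y \<le> x \<Longrightarrow> x < 2 ^ w \<Longrightarrow> eval_binop w Sub x y = x - y"
  by (simp add: le_mod_geq)

lemma eval_Mul: "x * y < 2 ^ w \<Longrightarrow> eval_binop w Mul x y = x * y"
  by simp

lemma eval_Shl_one: "2 ^ x < (2::nat) ^ w \<Longrightarrow> eval_binop w Shl 1 x = 2 ^ x"
  by (simp add: push_bit_eq_mult)

lemma eval_Shr: "eval_binop w Shr x y = x div 2 ^ y"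
  by (simp add: drop_bit_eq_div)

lemma eval_And_one: "eval_binop w And x 1 = x mod 2"
  by (simp add: and_one_eq)

lemma eval_Or_same: "eval_binop w Or x x = x"
  by simp

lemmas eval_simps = eval_Add eval_Mul eval_Sub eval_Shl_one eval_Shr eval_And_one eval_Or_same
  eval_binop.simps(4,5,11,12)

declare eval_binop.simps [simp del]

section \<open>Wavelet matrices\<close>

definition stable_part :: "('a \<Rightarrow> bool) \<Rightarrow> 'a list \<Rightarrow> 'a list" where
  "stable_part P xs = filter (\<lambda>x. \<not> P x) xs @ filter P xs"

text \<open>The rank mapping of a wavelet matrix. As a boundary between entries, \<open>i\<close>
  goes to the boundary behind those of the first \<open>i\<close> entries that have bit
  \<open>b\<close>; if entry \<open>i\<close> itself has bit \<open>b\<close>, the value is also its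
  new index.\<close>

definition part_pos :: "('a \<Rightarrow> bool) \<Rightarrow> 'a list \<Rightarrow> bool \<Rightarrow> nat \<Rightarrow> nat" where
  "part_pos P xs b i =
    (if b then length (filter (\<lambda>x. \<not> P x) xs) else 0) + length (filter (\<lambda>x. P x = b) (take i xs))"

lemma length_stable_part [simp]: "length (stable_part P xs) = length xs"
  unfolding stable_part_def using sum_length_filter_compl[of P xs] by simp

lemma set_stable_part [simp]: "set (stable_part P xs) = set xs"
  unfolding stable_part_def by auto

lemma sum_list_stable_part:
  fixes f :: "'a \<Rightarrow> 'b::comm_monoid_add"
  shows "sum_list (map f (stable_part P xs)) = sum_list (map f xs)"
  unfolding stable_part_def by (induction xs) (simp_all add: algebra_simps)

lemma part_pos_le: "part_pos P xs b i \<le> length xs"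
proof -
  have xs: "length (filter Q xs) = length (filter Q (take i xs)) + length (filter Q (drop i xs))" for Q
    by (metis append_take_drop_id filter_append length_append)
  show ?thesis
    unfolding part_pos_def
    using sum_length_filter_compl[of P xs] xs[of P] xs[of "\<lambda>x. \<not> P x"] by (cases b) simp_all
qed

lemma part_pos_mono: "i \<le> j \<Longrightarrow> part_pos P xs b i \<le> part_pos P xs b j"
proof -
  assume "i \<le> j"
  then have "take j xs = take i xs @ take (j - i) (drop i xs)"
    by (metis le_add_diff_inverse take_add)
  then show ?thesis by (simp add: part_pos_def)
qed

lemma part_pos_Suc:
  "i < length xs \<Longrightarrow> part_pos P xs b (Suc i) = part_pos P xs b i + of_bool (P (xs ! i) = b)"
  by (simp add: part_pos_def take_Suc_conv_app_nth)

lemma nth_stable_part: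
  assumes "i < length xs"
  shows "part_pos P xs (P (xs ! i)) i < length xs"
    and "stable_part P xs ! part_pos P xs (P (xs ! i)) i = xs ! i"
proof -
  show "part_pos P xs (P (xs ! i)) i < length xs"
    \<comment> \<open>The boundary behind entry \<open>i\<close> is one larger and still at most
      \<open>length xs\<close>.\<close>
    using part_pos_le[of P xs "P (xs ! i)" "Suc i"] part_pos_Suc[OF assms, of P "P (xs ! i)"]
    by simp
  have xs: "xs = take i xs @ xs ! i # drop (Suc i) xs"
    using assms by (rule id_take_nth_drop)
  have "filter Q xs = filter Q (take i xs) @ (if Q (xs ! i) then [xs ! i] else [])
      @ filter Q (drop (Suc i) xs)" for Q
    by (subst xs) simp
  then show "stable_part P xs ! part_pos P xs (P (xs ! i)) i = xs ! i"
    by (cases "P (xs ! i)") (simp_all add: stable_part_def part_pos_def nth_append)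
qed

text \<open>Both halves keep the order of \<open>xs\<close>, so the entries of a segment that share
  a bit stay adjacent. A segment can therefore be carried down by its two ends alone.\<close>

lemma segment_stable_part:
  assumes "lo \<le> hi"
  shows "drop (part_pos P xs b lo) (take (part_pos P xs b hi) (stable_part P xs)) =
    filter (\<lambda>x. P x = b) (drop lo (take hi xs))"
proof -
  have hi: "take hi xs = take lo xs @ drop lo (take hi xs)"
    by (metis append_take_drop_id assms min.absorb1 take_take)
  have *: "filter Q xs = filter Q (take lo xs) @ filter Q (drop lo (take hi xs)) @ filter Q (drop hi xs)"
    for Q
    by (metis append.assoc append_take_drop_id filter_append hi)
  have "length (filter Q (take hi xs)) =
      length (filter Q (take lo xs)) + length (filter Q (drop lo (take hi xs)))" for Q
    by (subst hi) simp
  then show ?thesis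
    using *[of P] *[of "\<lambda>x. \<not> P x"]
    by (cases b) (simp_all add: stable_part_def part_pos_def)
qed

text \<open>Bits are used from the most significant downwards: for keys below \<open>2 ^ H\<close>,
  fixing the first \<open>k\<close> of them confines the key to an aligned interval of length
  \<open>2 ^ (H - k)\<close>.\<close>

fun wavelet_level :: "nat \<Rightarrow> (nat \<times> 'b) list \<Rightarrow> nat \<Rightarrow> (nat \<times> 'b) list" where
  "wavelet_level H ys 0 = ys"
| "wavelet_level H ys (Suc k) = stable_part (\<lambda>p. bit (fst p) (H - 1 - k)) (wavelet_level H ys k)"

lemma length_wavelet_level [simp]: "length (wavelet_level H ys k) = length ys"
  by (induction k) simp_all

lemma set_wavelet_level [simp]: "set (wavelet_level H ys k) = set ys"
  by (induction k) simp_all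

section \<open>The query program\<close>

text \<open>
  Registers 1 to 6 hold \<open>1\<close>, \<open>H\<close> and the array offsets \<open>stride\<close>, \<open>2 * stride\<close>, \<open>3 * stride\<close> and
  \<open>5 * stride\<close>; 0 accumulates the answer, 7 is the level, 8 a power of two for binary search,
  9 and 10 delimit the current segment of the level, 11 is the rank prefix, 14 the number of
  points and 15 stays zero. Each subprogram works in its own block of registers (from 20, 30 or 40
  upwards), so it preserves those of its callers.
\<close>

definition next_prog :: com where
  "next_prog = seqs [
    Op 44 Mod 40 2, Op 44 Sub 40 44,
    Op 45 Mul 42 3, Op 45 Add 45 5, Op 45 Add 45 44, Op 45 Add 45 41, Load 43 45,
    Op 46 Less 44 40,
    While 46 (seqs [
      Op 47 Add 3 44, Load 47 47, Op 47 Shr 47 41, Op 47 And 47 1, Op 47 Equal 47 42,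
      Op 43 Add 43 47, Op 44 Add 44 1, Op 46 Less 44 40])]"

definition trace_prog :: com where
  "trace_prog = seqs [
    Op 32 Less 31 2,
    While 32 (seqs [
      Move 40 30, Move 41 31,
      Op 42 Add 3 30, Load 42 42, Op 42 Shr 42 31, Op 42 And 42 1,
      next_prog, Move 30 43, Op 31 Add 31 1, Op 32 Less 31 2])]"

definition prefix_prog :: com where
  "prefix_prog = seqs [
    Op 22 Mod 20 2, Op 22 Sub 20 22, Op 21 Add 6 22, Op 21 Add 21 7, Load 21 21,
    Op 23 Less 22 20,
    While 23 (seqs [
      Move 30 22, Op 31 Add 7 1, trace_prog, Op 30 Add 4 30, Load 30 30,
      Op 21 Add 21 30, Op 22 Add 22 1, Op 23 Less 22 20])]"

section \<open>Layout of the stored structure\<close>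

locale wavelet =
  fixes H w :: nat and ys :: "(nat \<times> nat) list" and as bs :: "real list"
  assumes H_pos: "0 < H"
    and length_ys: "length ys = 2 ^ H - 1"
    and word_address: "6 * (2 ^ H + H + 1) < (2::nat) ^ w"
    and word_weight: "2 * sum_list (map snd ys) < 2 ^ w"
begin

text \<open>An array must accommodate every index \<open>x + k\<close> with
  \<open>x \<le> length ys\<close> and \<open>k < H\<close>. In these terms
  \<open>word_address\<close> says that six arrays can be addressed without overflow.\<close>

definition stride :: nat where
  "stride = 2 ^ H + H + 1"

abbreviation level :: "nat \<Rightarrow> (nat \<times> nat) list" where
  "level \<equiv> wavelet_level H ys"

definition level_bit :: "nat \<Rightarrow> nat \<times> nat \<Rightarrow> bool" where
  "level_bit k p \<longleftrightarrow> bit (fst p) (H - 1 - k)"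

definition child :: "nat \<Rightarrow> bool \<Rightarrow> nat \<Rightarrow> nat" where
  "child k = part_pos (level_bit k) (level k)"

lemma level_Suc: "level (Suc k) = stable_part (level_bit k) (level k)"
  by (simp add: level_bit_def[abs_def])

text \<open>Bit \<open>k\<close> belongs to the entry at position \<open>x\<close> of level
  \<open>k\<close>. That entry changes with \<open>k\<close>, so the word is in general not a
  key.\<close>

definition bits_word :: "nat \<Rightarrow> nat" where
  "bits_word x = horner_sum of_bool 2 (map (\<lambda>k. level_bit k (level k ! x)) [0..<H])"

definition prefix_weight :: "nat \<Rightarrow> nat \<Rightarrow> nat" where
  "prefix_weight k i = sum_list (map snd (take i (level k)))"

text \<open>
  Six word arrays of length \<open>stride\<close>: a header, the packed bits, the weights of the last level,
  and samples of \<open>child\<close> and \<open>prefix_weight\<close>. Since sampled positions are multiples of \<open>H\<close>, the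
  sample at position \<open>x\<close> on level \<open>k < H\<close> is stored at index \<open>x + k\<close>; the prefix weights
  there belong to level \<open>k + 1\<close>.
\<close>

definition cell :: "nat \<Rightarrow> nat \<Rightarrow> nat" where
  "cell j y =
    (if j = 0 then if y = 0 then H else stride
     else if j = 1 then if y < length ys then bits_word y else 0
     else if j = 2 then if y < length ys then snd (level H ! y) else 0
     else if j = 3 then child (y mod H) False (y - y mod H)
     else if j = 4 then child (y mod H) True (y - y mod H)
     else prefix_weight (Suc (y mod H)) (y - y mod H))"

definition mem :: image where
  "mem = (map (\<lambda>a. cell (a div stride) (a mod stride)) [0..<6 * stride], as @ bs)"

lemma stride_bound: "6 * stride < 2 ^ w"
  using word_address by (simp add: stride_def)

lemma stride_gt: "length ys + H < stride"
  by (simp add: stride_def length_ys)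

lemma mem_nth: "j < 6 \<Longrightarrow> y < stride \<Longrightarrow>
    j * stride + y < length (fst mem) \<and> fst mem ! (j * stride + y) = cell j y"
proof -
  assume *: "j < 6" "y < stride"
  then have "j \<le> 5" by simp
  then have "j * stride \<le> 5 * stride" by (rule mult_le_mono1)
  with *(2) have "j * stride + y < 6 * stride" by linarith
  with * show ?thesis by (simp add: mem_def)
qed

lemma bits_word_bound: "bits_word x < 2 ^ H"
  unfolding bits_word_def using horner_sum_of_bool_2_less[of "map (\<lambda>k. level_bit k (level k ! x)) [0..<H]"]
  by simp

lemma bits_word_bit: "k < H \<Longrightarrow> bits_word x div 2 ^ k mod 2 = of_bool (level_bit k (level k ! x))"
proof -
  assume "k < H"
  then have "bit (bits_word x) k = level_bit k (level k ! x)"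
    by (simp add: bits_word_def bit_horner_sum_bit_iff level_bit_def)
  then show ?thesis
    by (simp add: mod_2_eq_odd flip: bit_iff_odd)
qed

lemma sum_level: "sum_list (map snd (level k)) = sum_list (map snd ys)"
  by (induction k) (simp_all add: sum_list_stable_part)

lemma prefix_weight_le: "prefix_weight k i \<le> sum_list (map snd ys)"
  unfolding prefix_weight_def
  by (metis append_take_drop_id le_add1 map_append sum_level sum_list_append)

lemma prefix_weight_Suc: "i < length ys \<Longrightarrow> prefix_weight k (Suc i) = prefix_weight k i + snd (level k ! i)"
  unfolding prefix_weight_def by (simp add: take_Suc_conv_app_nth)

lemma child_le: "child k b i \<le> length ys"
  using part_pos_le[of "level_bit k" "level k"] by (simp add: child_def)

lemma cell_bound: "cell j y < 2 ^ w"
proof -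
  have s: "stride < 2 ^ w" "H < 2 ^ w" "length ys < 2 ^ w" "(2::nat) ^ H < 2 ^ w"
    using stride_bound stride_gt stride_def by linarith+
  have "snd (level H ! y) \<le> sum_list (map snd ys)" if "y < length ys"
    using prefix_weight_Suc[OF that, of H] prefix_weight_le[of H "Suc y"] by simp
  then have "snd (level H ! y) < 2 ^ w" if "y < length ys"
    using that word_weight by fastforce
  moreover have "child k b i < 2 ^ w" for k b i
    using child_le s(3) by (rule le_less_trans)
  moreover have "prefix_weight k i < 2 ^ w" for k i
    using prefix_weight_le[of k i] word_weight by linarith
  moreover have "bits_word y < 2 ^ w"
    using bits_word_bound s(4) by (rule less_trans)
  ultimately show ?thesis
    using s(1,2) by (simp add: cell_def)
qed

lemma valid_mem: "valid_image w mem"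
  using cell_bound by (auto simp: valid_image_def mem_def)

definition base_regs :: "(nat \<Rightarrow> nat) \<Rightarrow> bool" where
  "base_regs u \<longleftrightarrow> u 1 = 1 \<and> u 2 = H \<and> u 3 = stride \<and> u 4 = 2 * stride \<and> u 5 = 3 * stride \<and> u 6 = 5 * stride"

lemma load_bits: "x < length ys \<Longrightarrow>
    stride + x < length (fst mem) \<and> fst mem ! (stride + x) = bits_word x"
  using mem_nth[of 1 x] stride_gt by (simp add: cell_def)

lemma load_weight: "x < length ys \<Longrightarrow>
    2 * stride + x < length (fst mem) \<and> fst mem ! (2 * stride + x) = snd (level H ! x)"
  using mem_nth[of 2 x] stride_gt by (simp add: cell_def)

text \<open>The address is written in the order in which \<open>next_prog\<close> adds it up; the
  factor \<open>of_bool b\<close> selects between arrays 3 and 4. As \<open>H\<close> divides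
  \<open>x\<close>, the index \<open>x + k\<close> determines both \<open>x\<close> and
  \<open>k\<close>.\<close>

lemma load_child:
  assumes "k < H" "H dvd x" "x \<le> length ys"
  shows "of_bool b * stride + 3 * stride + x + k < length (fst mem) \<and>
    fst mem ! (of_bool b * stride + 3 * stride + x + k) = child k b x"
proof -
  have "x + k < stride" "(x + k) mod H = k"
    using stride_gt assms by (auto elim: dvdE)
  then show ?thesis
    using mem_nth[of 3 "x + k"] mem_nth[of 4 "x + k"]
    by (cases b) (simp_all add: cell_def add.assoc)
qed

lemma load_prefix:
  assumes "k < H" "H dvd x" "x \<le> length ys"
  shows "5 * stride + x + k < length (fst mem) \<and>
    fst mem ! (5 * stride + x + k) = prefix_weight (Suc k) x"
proof -
  have "x + k < stride" "(x + k) mod H = k"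
    using stride_gt assms by (auto elim: dvdE)
  then show ?thesis
    using mem_nth[of 5 "x + k"]
    by (simp add: cell_def add.assoc)
qed


section \<open>Ranks, traces and prefix weights: correctness and cost\<close>

definition next_time :: nat where
  "next_time = 9 * H + 9"

text \<open>The sample is read at \<open>x0\<close>, the last multiple of \<open>H\<close> up to
  \<open>i\<close>. Fewer than \<open>H\<close> entries remain, and by \<open>part_pos_Suc\<close>
  each contributes 1 exactly if its bit equals \<open>b\<close>.\<close>

lemma wp_next:
  assumes base: "base_regs u" and k: "u 41 = k" "k < H" and b: "u 42 = of_bool b"
    and i: "u 40 = i" "i \<le> length ys"
    and Q: "\<And>t u'. t \<le> next_time \<Longrightarrow> u' 43 = child k b i \<Longrightarrow> (\<And>x. x < 43 \<Longrightarrow> u' x = u x) \<Longrightarrow> Q t (u', r)"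
  shows "wp w mem next_prog (u, r) Q"
proof -
  note nb = base[unfolded base_regs_def]
  define x0 where "x0 = i - i mod H"
  have x0: "H dvd x0" "x0 \<le> i" "i - x0 < H"
    using H_pos by (auto simp: x0_def minus_mod_eq_mult_div[symmetric])
  note bounds = stride_bound stride_gt k(2) i(2) x0(2)
  have arith: "eval_binop w Sub i (i mod H) = x0" "eval_binop w Mul (of_bool b) stride = of_bool b * stride"
    "eval_binop w Add (of_bool b * stride) (3 * stride) = of_bool b * stride + 3 * stride"
    "eval_binop w Add (of_bool b * stride + 3 * stride) x0 = of_bool b * stride + 3 * stride + x0"
    "eval_binop w Add (of_bool b * stride + 3 * stride + x0) k = of_bool b * stride + 3 * stride + x0 + k"
    subgoal using bounds by (subst eval_Sub) (simp_all add: x0_def)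
    subgoal using bounds by (cases b) (simp_all add: eval_simps)
    subgoal using bounds by (cases b) (simp_all add: eval_simps)
    subgoal using bounds by (cases b) (simp_all add: eval_simps)
    subgoal using bounds by (cases b) (simp_all add: eval_simps)
    done
  define I where "I j u' r' \<longleftrightarrow> r' = r \<and> (\<forall>x<43. u' x = u x) \<and> u' 44 = x0 + j \<and>
    u' 43 = child k b (x0 + j) \<and> u' 46 = of_bool (x0 + j < i)" for j u' and r' :: "nat \<Rightarrow> real"
  have step: "u' 46 \<noteq> 0 \<and> wp w mem (seqs [
      Op 47 Add 3 44, Load 47 47, Op 47 Shr 47 41, Op 47 And 47 1, Op 47 Equal 47 42,
      Op 43 Add 43 47, Op 44 Add 44 1, Op 46 Less 44 40])
      (u', r') (\<lambda>t s'. t \<le> 8 \<and> I (Suc j) (fst s') (snd s'))"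
    if j: "j < i - x0" and I: "I j u' r'" for j u' r'
  proof -
    define x where "x = x0 + j"
    have x: "x < i" "x < length ys" using j i(2) by (auto simp: x_def)
    have child: "child k b (Suc x) = child k b x + of_bool (level_bit k (level k ! x) = b)"
      unfolding child_def by (rule part_pos_Suc) (simp add: x(2))
    have ar: "eval_binop w Add stride x = stride + x" "eval_binop w Add x 1 = Suc x"
      "eval_binop w Add (child k b x) (of_bool (level_bit k (level k ! x) = b)) = child k b (Suc x)"
      "(of_bool (level_bit k (level k ! x)) = (of_bool b :: nat)) = (level_bit k (level k ! x) = b)"
      subgoal using bounds x by (simp add: eval_simps del: One_nat_def split del: split_of_bool)
      subgoal using bounds x by (simp add: eval_simps del: One_nat_def split del: split_of_bool)
      subgoal unfolding child
        by (rule eval_Add) (use bounds child_le[of k b "Suc x"] child in linarith)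
      subgoal by simp
      done
    show ?thesis
      using I x j nb k(1) i b(1)
      by (simp add: I_def x_def[symmetric] wp_simps load_bits eval_Shr bits_word_bit[OF k(2)] ar
          eval_And_one eval_binop.simps(11,12) del: One_nat_def split del: split_of_bool)
  qed
  show ?thesis
    unfolding next_prog_def
    apply (simp add: wp_simps nb k(1) b i(1) arith eval_binop.simps(5) load_child k(2) x0 
        order_trans[OF x0(2) i(2)] eval_binop.simps(11) del: One_nat_def split del: split_of_bool)
    apply (rule wp_counted_loop[where I = I and n = "i - x0" and B = 8])
    subgoal for j u' r'
      using step[of j u' r'] by (simp add: I_def)
    subgoal by (simp add: I_def)
    subgoal using x0(2) by (simp add: I_def)
    subgoal for t u' r'
      using x0(2,3) by (auto simp: I_def next_time_def intro!: Q)
    done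
qed

definition trace_time :: nat where
  "trace_time = H * (next_time + 10) + 2"

text \<open>On every level the entry follows its own bit, and \<open>nth_stable_part\<close> finds
  it again on the next level. The conclusion identifies the entry reached on level \<open>H\<close>,
  where its weight is stored.\<close>

lemma wp_trace:
  assumes base: "base_regs u" and k: "u 31 = k" "k \<le> H" and i: "u 30 = i" "i < length ys"
    and Q: "\<And>t u'. t \<le> trace_time \<Longrightarrow> u' 30 < length ys \<Longrightarrow> level H ! u' 30 = level k ! i \<Longrightarrow>
      (\<And>x. x < 30 \<Longrightarrow> u' x = u x) \<Longrightarrow> Q t (u', r)"
  shows "wp w mem trace_prog (u, r) Q"
proof -
  note nb = base[unfolded base_regs_def]
  define I where "I j u' r' \<longleftrightarrow> r' = r \<and> (\<forall>x<30. u' x = u x) \<and> u' 31 = k + j \<and> u' 30 < length ys \<and>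
    level (k + j) ! u' 30 = level k ! i \<and> u' 32 = of_bool (k + j < H)" for j u' and r' :: "nat \<Rightarrow> real"
  have step: "u' 32 \<noteq> 0 \<and> wp w mem (seqs [
      Move 40 30, Move 41 31,
      Op 42 Add 3 30, Load 42 42, Op 42 Shr 42 31, Op 42 And 42 1,
      next_prog, Move 30 43, Op 31 Add 31 1, Op 32 Less 31 2])
      (u', r') (\<lambda>t s'. t \<le> next_time + 9 \<and> I (Suc j) (fst s') (snd s'))"
    if j: "j < H - k" and I: "I j u' r'" for j u' r'
  proof -
    define x where "x = u' 30"
    define l where "l = k + j"
    have l: "l < H" and x: "x < length ys" using j I by (auto simp: l_def x_def I_def)
    have lx: "u' 31 = l" "u' 30 = x" "level l ! x = level k ! i" using I by (auto simp: l_def x_def I_def)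
    have ar: "eval_binop w Add stride x = stride + x" "eval_binop w Add l 1 = Suc l"
      using stride_bound stride_gt x l by (simp_all add: eval_simps del: One_nat_def split del: split_of_bool)
    have next_level: "child l (level_bit l (level l ! x)) x < length ys"
      "level (Suc l) ! child l (level_bit l (level l ! x)) x = level l ! x"
      using nth_stable_part[of x "level l" "level_bit l"] x unfolding level_Suc child_def by simp_all
    have nb': "base_regs u'" using I base by (simp add: I_def base_regs_def)
    note nbu = nb'[unfolded base_regs_def]
    show ?thesis
      apply (rule conjI)
      subgoal using I l by (simp add: I_def l_def)
      apply (simp add: wp_simps nbu lx(1,2) ar load_bits[OF x] eval_Shr bits_word_bit[OF l]
          eval_And_one eval_Or_same del: One_nat_def split del: split_of_bool)
      apply (rule wp_next[where k = l and b = "level_bit l (level l ! x)" and i = x])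
      subgoal using nb' by (simp add: base_regs_def)
      subgoal by simp
      subgoal by (rule l)
      subgoal by simp
      subgoal by simp
      subgoal using x by simp
      subgoal for t u2
        using I nb lx next_level
        by (simp add: wp_simps nbu ar eval_Or_same eval_binop.simps(11) I_def l_def[symmetric] del: One_nat_def wavelet_level.simps split del: split_of_bool)
      done
  qed
  show ?thesis
    unfolding trace_prog_def
    apply (simp add: wp_simps nb k(1) eval_binop.simps(11) del: One_nat_def split del: split_of_bool)
    apply (rule wp_counted_loop[where I = I and n = "H - k" and B = "next_time + 9"])
    subgoal for j u' r'
      using step[of j u' r'] by (simp add: I_def)
    subgoal using k(2) by (simp add: I_def)
    subgoal using k i by (simp add: I_def)
    subgoal for t u' r'
    proof -
      assume t: "t \<le> (H - k) * Suc (next_time + 9) + 1" and I: "I (H - k) u' r'"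
      have "(H - k) * (next_time + 10) \<le> H * (next_time + 10)" by (rule mult_le_mono1) simp
      moreover have "Suc (next_time + 9) = next_time + 10" by simp
      ultimately have "Suc t \<le> trace_time" using t by (simp only: trace_time_def)
      with I k(2) show ?thesis by (auto simp: I_def intro!: Q)
    qed
    done
qed

definition prefix_time :: nat where
  "prefix_time = H * (trace_time + 9) + 7"

text \<open>To the sample at \<open>x0\<close>, which belongs to level \<open>k + 1\<close>, the
  fewer than \<open>H\<close> missing weights are added; each of them is read on level
  \<open>H\<close> after a trace.\<close>

lemma wp_prefix:
  assumes base: "base_regs u" and k: "u 7 = k" "k < H" and i: "u 20 = i" "i \<le> length ys"
    and Q: "\<And>t u'. t \<le> prefix_time \<Longrightarrow> u' 21 = prefix_weight (Suc k) i \<Longrightarrow>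
      (\<And>x. x < 20 \<Longrightarrow> u' x = u x) \<Longrightarrow> Q t (u', r)"
  shows "wp w mem prefix_prog (u, r) Q"
proof -
  note nb = base[unfolded base_regs_def]
  define x0 where "x0 = i - i mod H"
  have x0: "H dvd x0" "x0 \<le> i" "i - x0 < H"
    using H_pos by (auto simp: x0_def minus_mod_eq_mult_div[symmetric])
  note bounds = stride_bound stride_gt k(2) i(2) x0(2)
  have arith: "eval_binop w Sub i (i mod H) = x0" 
    "eval_binop w Add (5 * stride) x0 = 5 * stride + x0"
    "eval_binop w Add (5 * stride + x0) k = 5 * stride + x0 + k"
    subgoal using bounds by (subst eval_Sub) (simp_all add: x0_def)
    subgoal using bounds by (simp add: eval_simps del: One_nat_def split del: split_of_bool)
    subgoal using bounds by (simp add: eval_simps del: One_nat_def split del: split_of_bool)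
    done
  define I where "I j u' r' \<longleftrightarrow> r' = r \<and> (\<forall>x<21. u' x = u x) \<and> u' 22 = x0 + j \<and>
    u' 21 = prefix_weight (Suc k) (x0 + j) \<and> u' 23 = of_bool (x0 + j < i)" for j u' and r' :: "nat \<Rightarrow> real"
  have step: "u' 23 \<noteq> 0 \<and> wp w mem (seqs [
      Move 30 22, Op 31 Add 7 1, trace_prog, Op 30 Add 4 30, Load 30 30,
      Op 21 Add 21 30, Op 22 Add 22 1, Op 23 Less 22 20])
      (u', r') (\<lambda>t s'. t \<le> trace_time + 8 \<and> I (Suc j) (fst s') (snd s'))"
    if j: "j < i - x0" and I: "I j u' r'" for j u' r'
  proof -
    define x where "x = x0 + j"
    have x: "x < i" "x < length ys" using j i(2) by (auto simp: x_def)
    have ux: "u' 22 = x" "u' 7 = k" "u' 20 = i" using I k i by (auto simp: x_def I_def)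
    have nb': "base_regs u'" using I base by (simp add: I_def base_regs_def)
    note nbu = nb'[unfolded base_regs_def]
    have ar: "eval_binop w Add k 1 = Suc k" "eval_binop w Add x 1 = Suc x"
      using stride_bound stride_gt x k by (simp_all add: eval_simps del: One_nat_def split del: split_of_bool)
    have ar2: "eval_binop w Add (2 * stride) y = 2 * stride + y" if "y < length ys" for y
      using stride_bound stride_gt that by (simp_all add: eval_simps del: One_nat_def split del: split_of_bool)
    have pw: "prefix_weight (Suc k) x + snd (level (Suc k) ! x) = prefix_weight (Suc k) (Suc x)"
      by (rule prefix_weight_Suc[symmetric]) (rule x(2))
    have ar3: "eval_binop w Add (prefix_weight (Suc k) x) (snd (level (Suc k) ! x)) = prefix_weight (Suc k) (Suc x)"
      unfolding pw[symmetric]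
      by (rule eval_Add) (use pw prefix_weight_le[of "Suc k" "Suc x"] word_weight in linarith)
    show ?thesis
      apply (rule conjI)
      subgoal using I x by (simp add: I_def x_def)
      apply (simp add: wp_simps nbu ux ar eval_Or_same del: One_nat_def split del: split_of_bool)
      \<comment> \<open>The trace starts on level \<open>Suc k\<close>. This may already be
        \<open>H\<close>, in which case its loop is not entered.\<close>
      apply (rule wp_trace[where k = "Suc k" and i = x])
      subgoal using nb' by (simp add: base_regs_def)
      subgoal by simp
      subgoal using k by simp
      subgoal by simp
      subgoal by (rule x(2))
      subgoal for t u2
        using I nb i
        by (simp add: wp_simps nbu ux ar ar2 ar3 load_weight eval_binop.simps(11) I_def x_def[symmetric]
            del: One_nat_def wavelet_level.simps split del: split_of_bool)
      done
  qed
  show ?thesis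
    unfolding prefix_prog_def
    apply (simp add: wp_simps nb k(1) i(1) arith eval_binop.simps(5) load_prefix k(2) x0 
        order_trans[OF x0(2) i(2)] eval_binop.simps(11) del: One_nat_def split del: split_of_bool)
    apply (rule wp_counted_loop[where I = I and n = "i - x0" and B = "trace_time + 8"])
    subgoal for j u' r'
      using step[of j u' r'] by (simp add: I_def)
    subgoal by (simp add: I_def)
    subgoal using x0(2) by (simp add: I_def)
    subgoal for t u' r'
    proof -
      assume t: "t \<le> (i - x0) * Suc (trace_time + 8) + 1" and I: "I (i - x0) u' r'"
      have "(i - x0) * (trace_time + 9) \<le> H * (trace_time + 9)"
        by (rule mult_le_mono1) (use x0(3) in simp)
      moreover have "Suc (trace_time + 8) = trace_time + 9" by simp
      ultimately have "t + 6 \<le> prefix_time" using t by (simp only: prefix_time_def)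
      with I x0(2) show ?thesis by (auto simp: I_def intro!: Q)
    qed
    done
qed

end

section \<open>Rank search combined with the descent through the levels\<close>

definition child_prog :: "nat \<Rightarrow> nat \<Rightarrow> nat \<Rightarrow> com" where
  "child_prog d i j = seqs [Move 40 i, Move 41 7, Move 42 d, next_prog, Move j 43]"

text \<open>Register 15 supplies the bit 0. Applied to both ends of a segment, the two results
  differ by the weight of the entries of the segment with bit 0.\<close>

definition child_prefix_prog :: "nat \<Rightarrow> com" where
  "child_prefix_prog i = Seq (child_prog 15 i 20) prefix_prog"

text \<open>Register 13 is still zero and register 1 holds one, so the two loads read the header
  cells at addresses 0 and 1.\<close>

definition init_prog :: com where
  "init_prog = seqs [
    Const 1 1, Load 2 13, Load 3 1, Op 4 Add 3 3, Op 5 Add 4 3, Op 6 Add 5 4,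
    Op 8 Shl 1 2, Op 14 Sub 8 1, Op 13 Less 7 2]"

definition search_step :: com where
  "search_step = seqs [
    Op 8 Shr 8 1, Op 12 Add 10 8, Op 12 Sub 12 1, LoadReal 2 12, LeReal 12 0 2,
    Op 12 Mul 12 8, Op 10 Add 10 12, Op 7 Add 7 1, Op 13 Less 7 2]"

text \<open>The search for the number of right ends up to \<open>x2\<close> fixes one bit of that
  number per round, and the same bit selects the child. If it is 1, all entries with bit 0 lie below
  the threshold and their weight is collected. Adding register 14 skips the left ends, which precede
  the right ends among the stored reals.\<close>

definition descend_step :: com where
  "descend_step = seqs [
    Op 8 Shr 8 1, Op 13 Add 11 8, Op 13 Sub 13 1, Op 13 Add 13 14, LoadReal 2 13, LeReal 12 2 1,
    Cond 12 (seqs [child_prefix_prog 10, Op 0 Add 0 21, child_prefix_prog 9, Op 0 Sub 0 21]) Skip,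
    child_prog 12 9 9, child_prog 12 10 10,
    Op 13 Mul 12 8, Op 11 Add 11 13, Op 7 Add 7 1, Op 13 Less 7 2]"

definition query_prog :: com where
  "query_prog = seqs [init_prog, While 13 search_step,
    Const 7 0, Op 8 Shl 1 2, Op 13 Less 7 2, While 13 descend_step]"

text \<open>
  The invariant of a binary search for the number of \<open>i < n\<close> with \<open>P i\<close>: the interval that is
  left has length \<open>s\<close>, a power of two, which is why \<open>n\<close> is one less than a power of two.
\<close>

definition search_inv :: "(nat \<Rightarrow> bool) \<Rightarrow> nat \<Rightarrow> nat \<Rightarrow> nat \<Rightarrow> bool" where
  "search_inv P n a s \<longleftrightarrow> a + s \<le> Suc n \<and> (\<forall>i<a. P i) \<and> (\<forall>i<n. a + s \<le> Suc i \<longrightarrow> \<not> P i)"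

lemma search_inv_init: "search_inv P n 0 (Suc n)"
  by (simp add: search_inv_def)

text \<open>The candidates for the count are the \<open>2 * s\<close> numbers from \<open>a\<close>
  on. Since \<open>P\<close> is closed downwards, the probe at \<open>a + s - 1\<close> decides
  whether the count is at least \<open>a + s\<close>.\<close>

lemma search_inv_step:
  assumes inv: "search_inv P n a (2 * s)" and s: "0 < s"
    and down: "\<And>i j. i \<le> j \<Longrightarrow> j < n \<Longrightarrow> P j \<Longrightarrow> P i"
  shows "search_inv P n (a + of_bool (P (a + s - 1)) * s) s"
proof -
  have "a + 2 * s \<le> Suc n" using inv by (simp add: search_inv_def)
  then have "a + s - 1 < n" using s by linarith
  then show ?thesis
    using inv s down[of _ "a + s - 1"] down[of "a + s - 1"]
    unfolding search_inv_def by (cases "P (a + s - 1)") fastforce+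
qed

lemma search_inv_exit: "search_inv P n a 1 \<Longrightarrow> i < n \<Longrightarrow> P i \<longleftrightarrow> i < a"
  by (auto simp: search_inv_def not_less)

text \<open>The aligned \<open>J\<close> contributes an even number to \<open>v div 2 ^ e\<close>,
  so the parity is decided by the offset \<open>v - J\<close>, whose quotient is 0 or 1.\<close>

lemma bit_in_aligned_block:
  fixes J v :: nat
  assumes "2 ^ Suc e dvd J" "J \<le> v" "v < J + 2 ^ Suc e"
  shows "bit v e \<longleftrightarrow> J + 2 ^ e \<le> v"
proof -
  obtain q where q: "J = 2 ^ Suc e * q" using assms(1) by blast
  define d where "d = v - J"
  have v: "v = d + 2 ^ e * (2 * q)" using assms(2) q by (simp add: d_def)
  have "d < 2 ^ e + 2 ^ e" using assms(2,3) by (simp add: d_def less_diff_conv2)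
  then have "d div 2 ^ e = of_bool (2 ^ e \<le> d)"
    by (auto simp: div_eq_0_iff not_le intro!: div_nat_eqI)
  moreover have "v div 2 ^ e = 2 * q + d div 2 ^ e" unfolding v by simp
  ultimately show ?thesis
    using assms(2) by (auto simp: bit_iff_odd d_def)
qed

text \<open>Translates the bit test of a level into halving the interval of ranks.\<close>

lemma filter_aligned_block:
  fixes xs :: "(nat \<times> 'b) list"
  assumes "2 ^ Suc e dvd J"
  shows "filter (\<lambda>p. bit (fst p) e = b) (filter (\<lambda>p. J \<le> fst p \<and> fst p < J + 2 ^ Suc e) xs) =
    filter (\<lambda>p. J + of_bool b * 2 ^ e \<le> fst p \<and> fst p < J + of_bool b * 2 ^ e + 2 ^ e) xs"
  using bit_in_aligned_block[OF assms]
  by (cases b) (auto intro!: filter_cong)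

lemma sum_list_filter_less_add:
  fixes xs :: "(nat \<times> nat) list"
  shows "sum_list (map snd (filter (\<lambda>p. fst p < J + s) xs)) =
    sum_list (map snd (filter (\<lambda>p. fst p < J) xs)) +
    sum_list (map snd (filter (\<lambda>p. J \<le> fst p \<and> fst p < J + s) xs))"
  by (induction xs) auto

context wavelet
begin

lemma prefix_weight_segment:
  assumes "lo \<le> hi"
  shows "prefix_weight k hi = prefix_weight k lo + sum_list (map snd (drop lo (take hi (level k))))"
proof -
  have "take hi (level k) = take lo (level k) @ drop lo (take hi (level k))"
    by (metis append_take_drop_id assms min.absorb1 take_take)
  then show ?thesis
    unfolding prefix_weight_def by (metis map_append sum_list_append)
qed

lemma child_segment:
  "lo \<le> hi \<Longrightarrow> drop (child k b lo) (take (child k b hi) (level (Suc k))) =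
    filter (\<lambda>p. level_bit k p = b) (drop lo (take hi (level k)))"
  unfolding child_def level_Suc by (rule segment_stable_part)

lemma child_mono: "i \<le> j \<Longrightarrow> child k b i \<le> child k b j"
  unfolding child_def by (rule part_pos_mono)

lemma wp_child_prog:
  assumes base: "base_regs u" and k: "u 7 = k" "k < H" and b: "u d = of_bool b"
    and i: "u src = i" "i \<le> length ys" and regs: "d < 40" "src < 40" "dst < 40"
    and Q: "\<And>t u'. t \<le> next_time + 4 \<Longrightarrow> u' dst = child k b i \<Longrightarrow>
      (\<And>x. x < 40 \<Longrightarrow> x \<noteq> dst \<Longrightarrow> u' x = u x) \<Longrightarrow> Q t (u', r)"
  shows "wp w mem (child_prog d src dst) (u, r) Q"
proof -
  have neq: "d \<noteq> 40" "d \<noteq> 41" "src \<noteq> 40" using regs by auto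
  show ?thesis
    unfolding child_prog_def
    apply (simp add: wp_simps eval_Or_same k(1) b i(1) neq del: One_nat_def split del: split_of_bool)
    apply (rule wp_next[where k = k and b = b and i = i])
    subgoal using base by (simp add: base_regs_def)
    subgoal by simp
    subgoal by (rule k(2))
    subgoal by simp
    subgoal by simp
    subgoal by (rule i(2))
    subgoal for t u'
      using regs by (auto simp: wp_simps eval_Or_same intro!: Q)
    done
qed

lemma wp_child_prefix_prog:
  assumes base: "base_regs u" and k: "u 7 = k" "k < H" and zero: "u 15 = 0"
    and i: "u src = i" "i \<le> length ys" and regs: "src < 20"
    and Q: "\<And>t u'. t \<le> next_time + prefix_time + 4 \<Longrightarrow> u' 21 = prefix_weight (Suc k) (child k False i) \<Longrightarrow>
      (\<And>x. x < 20 \<Longrightarrow> u' x = u x) \<Longrightarrow> Q t (u', r)"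
  shows "wp w mem (child_prefix_prog src) (u, r) Q"
  unfolding child_prefix_prog_def wp_Seq
  apply (rule wp_child_prog[OF base k _ i, where b = False])
  subgoal using zero by simp
  subgoal by simp
  subgoal using regs by simp
  subgoal by simp
  subgoal for t u'
    apply (rule wp_prefix[where k = k and i = "child k False i"])
    subgoal using base by (simp add: base_regs_def)
    subgoal using k by simp
    subgoal by (rule k(2))
    subgoal by simp
    subgoal by (rule child_le)
    subgoal by (auto intro!: Q)
    done
  done

end

section \<open>Correctness of the query on sorted points\<close>

locale sorted_wavelet = wavelet +
  assumes length_as: "length as = 2 ^ H - 1"
    and length_bs: "length bs = 2 ^ H - 1"
    and as_desc: "\<And>i j. i \<le> j \<Longrightarrow> j < length as \<Longrightarrow> as ! j \<le> as ! i"
    and bs_asc: "\<And>i j. i \<le> j \<Longrightarrow> j < length bs \<Longrightarrow> bs ! i \<le> bs ! j"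
    and fst_less: "\<And>p. p \<in> set ys \<Longrightarrow> fst p < 2 ^ H - 1"
begin

lemma Suc_length_ys: "Suc (length ys) = 2 ^ H"
  using length_ys by simp

lemma two_pow_bound: "4 * 2 ^ H < (2::nat) ^ w"
  using stride_bound by (simp add: stride_def)

definition search_state :: "real \<Rightarrow> real \<Rightarrow> nat \<Rightarrow> (nat \<Rightarrow> nat) \<Rightarrow> (nat \<Rightarrow> real) \<Rightarrow> bool" where
  "search_state x1 x2 j u r \<longleftrightarrow> base_regs u \<and> u 0 = 0 \<and> u 9 = 0 \<and> u 11 = 0 \<and> u 14 = length ys \<and>
    u 15 = 0 \<and> u 7 = j \<and> u 8 = 2 ^ (H - j) \<and> u 13 = of_bool (j < H) \<and> r 0 = x1 \<and> r 1 = x2 \<and>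
    search_inv (\<lambda>i. x1 \<le> as ! i) (length ys) (u 10) (2 ^ (H - j))"

text \<open>\<open>I\<close> is the outcome of the first search, so \<open>take I ys\<close>
  consists of the points with left end at least \<open>x1\<close>. The divisibility of
  \<open>u 11\<close> keeps the block of ranks aligned, as \<open>filter_aligned_block\<close>
  demands in the next round.\<close>

definition descend_state :: "real \<Rightarrow> nat \<Rightarrow> nat \<Rightarrow> (nat \<Rightarrow> nat) \<Rightarrow> (nat \<Rightarrow> real) \<Rightarrow> bool" where
  "descend_state x2 I j u r \<longleftrightarrow> base_regs u \<and> u 14 = length ys \<and> u 15 = 0 \<and> u 7 = j \<and> 
    u 8 = 2 ^ (H - j) \<and> u 13 = of_bool (j < H) \<and> r 1 = x2 \<and>
    search_inv (\<lambda>i. bs ! i \<le> x2) (length ys) (u 11) (2 ^ (H - j)) \<and> 2 ^ (H - j) dvd u 11 \<and>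
    u 9 \<le> u 10 \<and> u 10 \<le> length ys \<and>
    drop (u 9) (take (u 10) (level j)) =
      filter (\<lambda>p. u 11 \<le> fst p \<and> fst p < u 11 + 2 ^ (H - j)) (take I ys) \<and>
    u 0 = sum_list (map snd (filter (\<lambda>p. fst p < u 11) (take I ys)))"

lemma wp_init_prog:
  assumes Q: "\<And>t u r. t \<le> 9 \<Longrightarrow> search_state x1 x2 0 u r \<Longrightarrow> Q t (u, r)"
  shows "wp w mem init_prog (query_state x1 x2) Q"
proof -
  \<comment> \<open>\<open>Const 1 1\<close> stores \<open>1 mod 2 ^ w\<close>, which is 1 only for
    positive \<open>w\<close>.\<close>
  have w: "0 < w"
    using two_pow_bound by (cases w) auto
  have m: "fst mem \<noteq> []" "fst mem ! 0 = H" "1 < length (fst mem)" "fst mem ! 1 = stride"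
    using mem_nth[of 0 0] mem_nth[of 0 1] stride_gt H_pos by (auto simp: cell_def)
  have ar: "eval_binop w Add stride stride = 2 * stride" "eval_binop w Add (2 * stride) stride = 3 * stride"
    "eval_binop w Add (3 * stride) (2 * stride) = 5 * stride" "eval_binop w Shl 1 H = 2 ^ H"
    "eval_binop w Sub (2 ^ H) 1 = length ys"
    subgoal using stride_bound by (simp add: eval_simps)
    subgoal using stride_bound by (simp add: eval_simps)
    subgoal using stride_bound by (simp add: eval_simps)
    subgoal by (rule eval_Shl_one) (use two_pow_bound in linarith)
    subgoal unfolding length_ys by (rule eval_Sub) (simp, use two_pow_bound in linarith)
    done
  show ?thesis
    unfolding init_prog_def query_state_def
    using H_pos search_inv_init[of _ "length ys"] Suc_length_ys
    by (auto simp: wp_simps w m ar eval_binop.simps(11) search_state_def base_regs_def simp del: One_nat_def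
      split del: split_of_bool intro!: Q)
qed

lemma wp_search_step:
  assumes j: "j < H" and s: "search_state x1 x2 j u r"
  shows "wp w mem search_step (u, r) (\<lambda>t s'. t \<le> 9 \<and> search_state x1 x2 (Suc j) (fst s') (snd s'))"
proof -
  define s where "s = (2::nat) ^ (H - Suc j)"
  define a where "a = u 10"
  have two: "2 ^ (H - j) = 2 * s" "0 < s"
    using j by (simp_all add: s_def Suc_diff_Suc flip: power_Suc)
  note st = s[unfolded search_state_def base_regs_def a_def[symmetric] two]
  have inv: "search_inv (\<lambda>i. x1 \<le> as ! i) (length ys) a (2 * s)"
    using st by blast
  have as: "a + 2 * s \<le> 2 ^ H" using inv Suc_length_ys by (simp add: search_inv_def)
  have len: "a + s - 1 < length as" using as two(2) by (simp add: length_as)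
  then have r: "a + s - 1 < length (snd mem)" "snd mem ! (a + s - 1) = as ! (a + s - 1)"
    by (simp_all add: mem_def nth_append del: One_nat_def)
  define b where "b \<longleftrightarrow> x1 \<le> as ! (a + s - 1)"
  have inv': "search_inv (\<lambda>i. x1 \<le> as ! i) (length ys) (a + of_bool b * s) s"
    unfolding b_def using inv two(2)
    by (rule search_inv_step) (use as_desc length_as length_ys in \<open>auto intro: order_trans\<close>)
  have ar: "eval_binop w Shr (2 * s) 1 = s" "eval_binop w Add a s = a + s" 
    "eval_binop w Sub (a + s) 1 = a + s - 1" "eval_binop w Mul (of_bool b) s = of_bool b * s"
    "eval_binop w Add a (of_bool b * s) = a + of_bool b * s" "eval_binop w Add j 1 = Suc j"
    subgoal by (simp add: eval_simps)
    subgoal using as two_pow_bound by (simp add: eval_simps)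
    subgoal by (rule eval_Sub) (use as two two_pow_bound in linarith)+
    subgoal using as two_pow_bound by (cases b) (simp_all add: eval_simps)
    subgoal using as two_pow_bound by (cases b) (simp_all add: eval_simps)
    subgoal by (subst eval_Add) (use j less_exp[of H] two_pow_bound in linarith, simp)
    done
  show ?thesis
    unfolding search_step_def using st inv'
    by (simp add: wp_simps ar r a_def[symmetric] b_def[symmetric] eval_binop.simps(11) search_state_def base_regs_def
        s_def[symmetric] del: One_nat_def split del: split_of_bool)
qed

text \<open>\<open>S\<close> is a difference of two prefix weights on the next level. The larger one
  is added before the smaller one is subtracted, so the intermediate value can reach the accumulator
  plus a prefix weight; each of them stays below half the word range.\<close>

lemma wp_collect:
  assumes base: "base_regs u" and k: "u 7 = k" "k < H" and zero: "u 15 = 0" and b: "u 12 = of_bool b"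
    and le: "u 9 \<le> u 10" "u 10 \<le> length ys" 
    and S: "S = sum_list (map snd (filter (\<lambda>p. level_bit k p = False) (drop (u 9) (take (u 10) (level k)))))"
    and acc: "2 * u 0 < 2 ^ w"
    and Q: "\<And>t u'. t \<le> 2 * next_time + 2 * prefix_time + 11 \<Longrightarrow> u' 0 = u 0 + of_bool b * S \<Longrightarrow>
      (\<And>x. 0 < x \<Longrightarrow> x < 20 \<Longrightarrow> u' x = u x) \<Longrightarrow> Q t (u', r)"
  shows "wp w mem (Cond 12 (seqs [child_prefix_prog 10, Op 0 Add 0 21, child_prefix_prog 9, Op 0 Sub 0 21]) Skip) (u, r) Q"
proof (cases b)
  case False
  then show ?thesis
    using b by (simp add: wp_simps) (rule Q, simp_all)
next
  case True
  define hi where "hi = prefix_weight (Suc k) (child k False (u 10))"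
  define lo where "lo = prefix_weight (Suc k) (child k False (u 9))"
  have hi: "hi = lo + S"
    unfolding hi_def lo_def S
    using prefix_weight_segment[OF child_mono[OF le(1)], where k = "Suc k"] child_segment[OF le(1)] by simp
  have "2 * hi < 2 ^ w"
    unfolding hi_def using prefix_weight_le[of "Suc k" "child k False (u 10)"] word_weight by linarith
  then have ar: "eval_binop w Add (u 0) hi = u 0 + hi" "eval_binop w Sub (u 0 + hi) lo = u 0 + S"
    using acc hi by (simp_all add: eval_simps)
  show ?thesis
    using b True
    apply (simp add: wp_Cond wp_Seq)
    apply (rule wp_child_prefix_prog[OF base k zero refl le(2)])
    subgoal by simp
    subgoal for t u1
      apply (simp add: wp_simps ar hi_def[symmetric])
      apply (rule wp_child_prefix_prog[where k = k and i = "u 9"])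
      subgoal using base by (simp add: base_regs_def)
      subgoal using k by simp
      subgoal by (rule k(2))
      subgoal using zero by simp
      subgoal by simp
      subgoal using le by simp
      subgoal by simp
      subgoal for t' u2
        by (simp add: wp_simps ar lo_def[symmetric]) (rule Q, simp_all)
      done
    done
qed

definition step_time :: nat where
  "step_time = 4 * next_time + 2 * prefix_time + 29"

lemma wp_descend_step:
  assumes j: "j < H" and s: "descend_state x2 I j u r"
  shows "wp w mem descend_step (u, r) (\<lambda>t s'. t \<le> step_time \<and> descend_state x2 I (Suc j) (fst s') (snd s'))"
proof -
  define s where "s = (2::nat) ^ (H - Suc j)"
  define a where "a = u 11"
  have two: "2 ^ (H - j) = 2 * s" "0 < s" "2 ^ Suc (H - 1 - j) = 2 * s" "2 ^ (H - 1 - j) = s"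
    using j by (simp_all add: s_def Suc_diff_Suc flip: power_Suc)
  note st = s[unfolded descend_state_def base_regs_def a_def[symmetric] two]
  have base: "base_regs u" using s by (simp add: descend_state_def)
  have inv: "search_inv (\<lambda>i. bs ! i \<le> x2) (length ys) a (2 * s)" and dvd: "2 * s dvd a"
    and le: "u 9 \<le> u 10" "u 10 \<le> length ys"
    and seg: "drop (u 9) (take (u 10) (level j)) = filter (\<lambda>p. a \<le> fst p \<and> fst p < a + 2 * s) (take I ys)"
    and acc: "u 0 = sum_list (map snd (filter (\<lambda>p. fst p < a) (take I ys)))"
    using st by blast+
  have as: "a + 2 * s \<le> 2 ^ H" using inv Suc_length_ys by (simp add: search_inv_def)
  have len: "a + s - 1 < length bs" using as two(2) by (simp add: length_bs)
  moreover have "length ys = length as" by (simp add: length_as length_ys)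
  ultimately have r: "a + s - 1 + length ys < length (snd mem)" "snd mem ! (a + s - 1 + length ys) = bs ! (a + s - 1)"
    by (simp_all add: mem_def nth_append del: One_nat_def)
  define b where "b \<longleftrightarrow> bs ! (a + s - 1) \<le> x2"
  have inv': "search_inv (\<lambda>i. bs ! i \<le> x2) (length ys) (a + of_bool b * s) s"
    unfolding b_def using inv two(2)
    by (rule search_inv_step) (use bs_asc length_bs length_ys in \<open>auto intro: order_trans\<close>)
  have ar: "eval_binop w Shr (2 * s) 1 = s" "eval_binop w Add a s = a + s" 
    "eval_binop w Sub (a + s) 1 = a + s - 1" "eval_binop w Mul (of_bool b) s = of_bool b * s"
    "eval_binop w Add (a + s - 1) (length ys) = a + s - 1 + length ys"
    "eval_binop w Add a (of_bool b * s) = a + of_bool b * s" "eval_binop w Add j 1 = Suc j"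
    subgoal by (simp add: eval_simps)
    subgoal using as two_pow_bound by (simp add: eval_simps)
    subgoal by (rule eval_Sub) (use as two two_pow_bound in linarith)+
    subgoal using as two_pow_bound by (cases b) (simp_all add: eval_simps)
    subgoal by (rule eval_Add) (use as two_pow_bound length_ys in linarith)
    subgoal using as two_pow_bound by (cases b) (simp_all add: eval_simps)
    subgoal by (subst eval_Add) (use j less_exp[of H] two_pow_bound in linarith, simp)
    done
  have bit_seg: "filter (\<lambda>p. level_bit j p = c) (drop (u 9) (take (u 10) (level j))) =
      filter (\<lambda>p. a + of_bool c * s \<le> fst p \<and> fst p < a + of_bool c * s + s) (take I ys)" for c
    using filter_aligned_block[of "H - 1 - j" a c "take I ys"] dvd
    unfolding level_bit_def seg two by simp
  define S where "S = sum_list (map snd (filter (\<lambda>p. level_bit j p = False) (drop (u 9) (take (u 10) (level j)))))"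
  \<comment> \<open>If the bit is 1, the block starts behind its lower half, whose weight
    \<open>S\<close> joins the accumulator; if it is 0, neither start nor accumulator moves.\<close>
  have acc': "u 0 + of_bool b * S = sum_list (map snd (filter (\<lambda>p. fst p < a + of_bool b * s) (take I ys)))"
    using sum_list_filter_less_add[of a s "take I ys"] bit_seg[of False] acc by (cases b) (simp_all add: S_def)
  have seg': "drop (child j b (u 9)) (take (child j b (u 10)) (level (Suc j))) = 
      filter (\<lambda>p. a + of_bool b * s \<le> fst p \<and> fst p < a + of_bool b * s + s) (take I ys)"
    using child_segment[OF le(1)] bit_seg by simp
  have dvd': "s dvd a + of_bool b * s"
    using dvd by (cases b) (auto elim: dvd_trans[rotated])
  \<comment> \<open>The accumulator never exceeds the total weight, so \<open>word_weight\<close>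
    keeps it below half the word range.\<close>
  have "sum_list (map snd (filter (\<lambda>p. fst p < a) (take I ys))) \<le> sum_list (map snd ys)"
  proof -
    have "sum_list (map snd (filter P xs)) \<le> sum_list (map snd xs)" for P and xs :: "(nat \<times> nat) list"
      by (induction xs) auto
    from this[of _ "take I ys"] show ?thesis
      using prefix_weight_le[of 0 I] by (auto simp: prefix_weight_def intro: order_trans)
  qed
  then have acc_bound: "2 * u 0 < 2 ^ w" using acc word_weight by linarith
  show ?thesis
    unfolding descend_step_def 
    apply (simp add: wp_simps(2-7) st ar r a_def[symmetric] b_def[symmetric] del: One_nat_def split del: split_of_bool)
    apply (rule wp_collect[unfolded seqs.simps, where k = j and b = b and S = S])
    subgoal using base by (simp add: base_regs_def)
    subgoal using st by simp
    subgoal by (rule j)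
    subgoal using st by simp
    subgoal by simp
    subgoal using le by simp
    subgoal using le by simp
    subgoal by (simp add: S_def)
    subgoal using acc_bound by simp
    subgoal for t u1
      apply (rule wp_child_prog[where k = j and b = b and i = "u 9"])
      subgoal using base by (simp add: base_regs_def)
      subgoal using st by simp
      subgoal by (rule j)
      subgoal by simp
      subgoal by simp
      subgoal using le by simp
      subgoal by simp
      subgoal by simp
      subgoal by simp
      subgoal for t2 u2
        apply (rule wp_child_prog[where k = j and b = b and i = "u 10"])
        subgoal using base by (simp add: base_regs_def)
        subgoal using st by simp
        subgoal by (rule j)
        subgoal by simp
        subgoal by simp
        subgoal using le by simp
        subgoal by simp
        subgoal by simp
        subgoal by simp
        subgoal for t3 u3
          using st inv' seg' dvd' acc' child_mono[OF le(1), of j b] child_le[of j b "u 10"]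
          by (simp add: wp_simps ar descend_state_def base_regs_def eval_binop.simps(11) step_time_def
              s_def[symmetric] a_def[symmetric] del: One_nat_def wavelet_level.simps split del: split_of_bool)
        done
      done
    done
qed

end

context sorted_wavelet
begin

definition query_time :: nat where
  "query_time = H * (step_time + 11) + 14"

text \<open>Left ends descend, so \<open>x1\<close> selects the first \<open>I\<close> points; right
  ends ascend, so \<open>x2\<close> selects the ranks below some \<open>J\<close>. After
  \<open>H\<close> rounds the accumulator holds the weight of the points meeting both
  conditions.\<close>

lemma query_prog_answers:
  "\<exists>t\<le>query_time. answers w mem query_prog x1 x2 t
    (\<Sum>i<length ys. if x1 \<le> as ! i \<and> bs ! fst (ys ! i) \<le> x2 then snd (ys ! i) else 0)"
    (is "\<exists>t\<le>_. answers _ _ _ _ _ _ ?ans")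
proof -
  have "wp w mem query_prog (query_state x1 x2) (\<lambda>t s. t \<le> query_time \<and> fst s 0 = ?ans)"
    unfolding query_prog_def seqs.simps wp_Seq
    apply (rule wp_init_prog)
    subgoal for t u r
      apply (rule wp_counted_loop[where I = "search_state x1 x2" and n = H and B = 9])
      subgoal for j u' r'
        using wp_search_step[of j x1 x2 u' r'] by (simp add: search_state_def)
      subgoal by (simp add: search_state_def)
      subgoal by simp
      subgoal for t1 u1 r1
      proof -
        assume t: "t \<le> 9" "t1 \<le> H * Suc 9 + 1" and s1: "search_state x1 x2 H u1 r1"
        define I where "I = u1 10"
        have "search_inv (\<lambda>i. x1 \<le> as ! i) (length ys) I 1"
          using s1 by (simp add: search_state_def I_def)
        then have I: "I \<le> length ys" "\<And>i. i < length ys \<Longrightarrow> x1 \<le> as ! i \<longleftrightarrow> i < I"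
          using search_inv_exit[of _ "length ys" I] by (auto simp: search_inv_def)
        have shl: "eval_binop w Shl 1 H = 2 ^ H"
          by (rule eval_Shl_one) (use two_pow_bound in linarith)
        \<comment> \<open>The initial block of ranks is everything below \<open>2 ^ H\<close>, so
          the descent starts with the whole prefix as its segment.\<close>
        have all: "filter (\<lambda>p. fst p < 2 ^ H) (take I ys) = take I ys"
          using fst_less by (fastforce simp: filter_id_conv dest: in_set_takeD)
        have s2: "descend_state x2 I 0 (u1(7 := 0, 8 := 2 ^ H, 13 := of_bool (0 < H))) r1"
          using s1 H_pos I(1) search_inv_init[of "\<lambda>i. bs ! i \<le> x2" "length ys"] 
          by (simp add: descend_state_def search_state_def base_regs_def Suc_length_ys I_def[symmetric] all)
        have regs: "u1 1 = 1" "u1 2 = H" using s1 by (simp_all add: search_state_def base_regs_def)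
        have final: "t + (t1 + (1 + (1 + (1 + t2)))) \<le> query_time \<and> u2 0 = ?ans"
          if t2: "t2 \<le> H * Suc step_time + 1" and s: "descend_state x2 I H u2 r2" for t2 u2 r2
        proof -
          define J where "J = u2 11"
          have "search_inv (\<lambda>i. bs ! i \<le> x2) (length ys) J 1"
            using s by (simp add: descend_state_def J_def)
          then have J: "i < length ys \<Longrightarrow> bs ! i \<le> x2 \<longleftrightarrow> i < J" for i
            using search_inv_exit[of _ "length ys" J] by auto
          have "u2 0 = sum_list (map snd (filter (\<lambda>p. fst p < J) (take I ys)))"
            using s by (simp add: descend_state_def J_def)
          also have "\<dots> = (\<Sum>p\<leftarrow>take I ys. if fst p < J then snd p else 0)"
            by (rule sum_list_map_filter')
          also have "\<dots> = (\<Sum>i<I. if fst (ys ! i) < J then snd (ys ! i) else 0)"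
            using I(1) by (auto simp: sum_list_sum_nth atLeast0LessThan intro!: sum.cong)
          also have "\<dots> = (\<Sum>i<length ys. if i < I \<and> fst (ys ! i) < J then snd (ys ! i) else 0)"
            using I(1) by (intro sum.mono_neutral_cong_left) auto
          \<comment> \<open>By \<open>fst_less\<close> each rank is a valid index of
            \<open>bs\<close>, so comparing it with \<open>J\<close> amounts to comparing its right
            end with \<open>x2\<close>.\<close>
          also have "\<dots> = ?ans"
            using I(2) J fst_less length_ys by (intro sum.cong refl) (metis lessThan_iff nth_mem)
          finally have "u2 0 = ?ans" .
          moreover have "t + (t1 + (1 + (1 + (1 + t2)))) \<le> query_time"
            using t t2 by (simp add: query_time_def algebra_simps)
          ultimately show ?thesis by simp
        qed
        show ?thesis
          apply (simp add: wp_simps regs shl eval_binop.simps(11) del: One_nat_def split del: split_of_bool)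
          apply (rule wp_counted_loop[where I = "descend_state x2 I" and n = H and B = step_time])
          subgoal for j u' r'
            using wp_descend_step[of j x2 I u' r'] by (simp add: descend_state_def)
          subgoal by (simp add: descend_state_def)
          subgoal by (rule s2)
          subgoal for t2 u2 r2
            using final[of t2 u2 r2] by simp
          done
      qed
      done
    done
  then show ?thesis
    unfolding wp_def answers_def by fastforce
qed

text \<open>One factor \<open>H\<close> each comes from the rounds of the descent, the weights
  missing from a sample, the levels of a trace and the bits missing from a sample. The constant is
  generous.\<close>

lemma query_time_le: "query_time \<le> 5000 * (H + 1) ^ 4"
proof -
  have "query_time \<le> 5000 * H ^ 4 + 5000 * H ^ 3 + 5000 * H ^ 2 + 5000 * H + 5000"
    unfolding query_time_def step_time_def prefix_time_def trace_time_def next_time_def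
    by (simp add: algebra_simps power2_eq_square power3_eq_cube power4_eq_xxxx)
  also have "\<dots> \<le> 5000 * (H + 1) ^ 4"
    by (simp add: algebra_simps power2_eq_square power3_eq_cube power4_eq_xxxx)
  finally show ?thesis .
qed

lemma space_mem_le: "space mem \<le> 14 * 2 ^ H"
proof -
  have "space mem = 6 * (2 ^ H + H + 1) + 2 * (2 ^ H - 1)"
    by (simp add: space_def mem_def stride_def length_as length_bs)
  moreover have "H + 1 \<le> 2 ^ H" using less_exp[of H] by linarith
  moreover have "6 * (N + H + 1) + 2 * (N - 1) \<le> 14 * N" if "H + 1 \<le> N" for N :: nat
    using that by simp
  ultimately show ?thesis by metis
qed

end

section \<open>Dominance sums for arbitrary weighted points\<close>

lemma dominance_sum:
  fixes pts :: "(real \<times> real \<times> nat) list"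
  assumes "0 < H" and len: "length pts = 2 ^ H - 1"
    and "6 * (2 ^ H + H + 1) < (2::nat) ^ w"
    and "2 * (\<Sum>(a, b, c)\<leftarrow>pts. c) < 2 ^ w"
  shows "\<exists>D. valid_image w D \<and> space D \<le> 14 * 2 ^ H \<and>
    (\<forall>x1 x2. \<exists>t\<le>5000 * (H + 1) ^ 4. answers w D query_prog x1 x2 t
      (\<Sum>(a, b, c)\<leftarrow>pts. if x1 \<le> a \<and> b \<le> x2 then c else 0))"
proof -
  define ps where "ps = rev (sort_key fst pts)"
  define bs where "bs = sort (map (\<lambda>(a, b, c). b) pts)"
  define as where "as = map fst ps"
  have mset: "mset ps = mset pts" by (simp add: ps_def)
  \<comment> \<open>With repeated right ends any index carrying the value \<open>b\<close> serves as
    rank, because the query compares only \<open>bs ! idx b\<close> with \<open>x2\<close>.\<close>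
  define idx where "idx b = (SOME v. v < length bs \<and> bs ! v = b)" for b
  define ys where "ys = map (\<lambda>(a, b, c). (idx b, c)) ps"
  have lens: "length ps = length pts" "length bs = length pts" "length ys = length pts" "length as = length pts"
    by (simp_all add: ps_def bs_def ys_def as_def)
  have idx: "idx b < length bs" "bs ! idx b = b" if "(a, b, c) \<in> set pts" for a b c
  proof -
    have "b \<in> set bs" using that by (force simp: bs_def)
    then have "\<exists>v. v < length bs \<and> bs ! v = b" by (metis in_set_conv_nth)
    then have "idx b < length bs \<and> bs ! idx b = b" unfolding idx_def by (rule someI_ex)
    then show "idx b < length bs" "bs ! idx b = b" by auto
  qed
  have sum_pts: "(\<Sum>p\<leftarrow>ps. f p) = (\<Sum>p\<leftarrow>pts. f p)" for f :: "real \<times> real \<times> nat \<Rightarrow> nat"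
    using mset by (metis mset_map sum_mset_sum_list)
  interpret sorted_wavelet H w ys as bs
  proof
    show "0 < H" "length ys = 2 ^ H - 1" "6 * (2 ^ H + H + 1) < (2::nat) ^ w"
      "length as = 2 ^ H - 1" "length bs = 2 ^ H - 1"
      using assms lens by auto
    have "sum_list (map snd ys) = (\<Sum>(a, b, c)\<leftarrow>ps. c)"
      by (simp add: ys_def o_def case_prod_unfold)
    then show "2 * sum_list (map snd ys) < 2 ^ w"
      using assms(4) sum_pts by simp
    have "sorted (rev as)"
      by (simp add: as_def ps_def rev_map)
    then show "as ! j \<le> as ! i" if "i \<le> j" "j < length as" for i j
      using that by (simp add: sorted_rev_nth_mono)
    show "bs ! i \<le> bs ! j" if "i \<le> j" "j < length bs" for i j
      using that by (simp add: bs_def sorted_nth_mono)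
    show "fst p < 2 ^ H - 1" if "p \<in> set ys" for p
      using that idx(1) len lens(2) by (auto simp: ys_def ps_def)
  qed
  have ans: "(\<Sum>i<length ys. if x1 \<le> as ! i \<and> bs ! fst (ys ! i) \<le> x2 then snd (ys ! i) else 0) =
      (\<Sum>(a, b, c)\<leftarrow>pts. if x1 \<le> a \<and> b \<le> x2 then c else 0)" for x1 x2
  proof -
    have "(\<Sum>i<length ys. if x1 \<le> as ! i \<and> bs ! fst (ys ! i) \<le> x2 then snd (ys ! i) else 0) =
        (\<Sum>i<length ps. (\<lambda>(a, b, c). if x1 \<le> a \<and> b \<le> x2 then c else 0) (ps ! i))"
    proof (rule sum.cong)
      fix i assume "i \<in> {..<length ps}"
      then have i: "i < length ps" by simp
      obtain a b c where p: "ps ! i = (a, b, c)" by (cases "ps ! i")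
      then have "(a, b, c) \<in> set pts" using i by (metis mset nth_mem set_mset_mset)
      from idx(2)[OF this] show "(if x1 \<le> as ! i \<and> bs ! fst (ys ! i) \<le> x2 then snd (ys ! i) else 0) =
          (\<lambda>(a, b, c). if x1 \<le> a \<and> b \<le> x2 then c else 0) (ps ! i)"
        using i p by (simp add: as_def ys_def)
    qed (simp add: lens)
    also have "\<dots> = (\<Sum>p\<leftarrow>ps. (\<lambda>(a, b, c). if x1 \<le> a \<and> b \<le> x2 then c else 0) p)"
      by (simp add: sum_list_sum_nth atLeast0LessThan)
    finally show ?thesis using sum_pts by simp
  qed
  show ?thesis
    using valid_mem space_mem_le query_prog_answers query_time_le unfolding ans
    by (meson order_trans)
qed

section \<open>Cliques and attribute intervals\<close>

definition cliques :: "nat \<Rightarrow> 'a graph \<Rightarrow> 'a set set" where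
  "cliques l G = {K \<in> nsets (verts G) l. nsets K 2 \<subseteq> edges G}"

text \<open>Every pair of vertices has an edge of the complete graph as image, hence shares its
  image with some edge of \<open>H\<close>; injectivity of \<open>f\<close> makes the two equal.
  Conversely, any bijection carries pairs onto pairs.\<close>

lemma isomorphic_clique_graph:
  assumes "simple_graph H"
  shows "isomorphic H (clique_graph l) \<longleftrightarrow> card (verts H) = l \<and> edges H = nsets (verts H) 2"
proof
  assume "isomorphic H (clique_graph l)"
  then obtain f where f: "bij_betw f (verts H) {..<l}" "(\<lambda>e. f ` e) ` edges H = nsets {..<l} 2"
    by (auto simp: isomorphic_def clique_graph_def)
  have inj: "inj_on f (verts H)" using f(1) by (rule bij_betw_imp_inj_on)
  have sub: "edges H \<subseteq> nsets (verts H) 2" using assms by (simp add: simple_graph_def)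
  have "e \<in> edges H" if e: "e \<in> nsets (verts H) 2" for e
  proof -
    have "e \<subseteq> verts H" using e by (simp add: nsets_def)
    moreover from this have "card (f ` e) = card e" using inj by (meson card_image inj_on_subset)
    ultimately have "f ` e \<in> nsets {..<l} 2"
      using e f(1) by (auto simp: nsets_def bij_betw_def)
    then have "f ` e \<in> (\<lambda>e. f ` e) ` edges H" using f(2) by simp
    then obtain e' where e': "e' \<in> edges H" "f ` e = f ` e'" by (rule imageE)
    then have "e' \<subseteq> verts H" using sub by (auto simp: nsets_def)
    then have "e = e'" using inj e'(2) \<open>e \<subseteq> verts H\<close> by (simp add: inj_on_image_eq_iff)
    then show ?thesis using e'(1) by simp
  qed
  then show "card (verts H) = l \<and> edges H = nsets (verts H) 2"
    using sub bij_betw_same_card[OF f(1)] by auto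
next
  assume H: "card (verts H) = l \<and> edges H = nsets (verts H) 2"
  have "finite (verts H)" using assms by (simp add: simple_graph_def)
  then obtain f where f: "bij_betw f (verts H) {..<l}"
    using H ex_bij_betw_finite_nat[of "verts H"] by (auto simp: atLeast0LessThan)
  then have "(\<lambda>e. f ` e) ` nsets (verts H) 2 = nsets {..<l} 2"
    using bij_betw_nsets[OF f, of 2] by (simp add: bij_betw_def)
  then show "isomorphic H (clique_graph l)"
    using f H by (auto simp: isomorphic_def clique_graph_def)
qed

text \<open>An occurrence of a clique is determined by its vertex set, so subgraphs may be replaced
  by sets of vertices.\<close>

lemma card_occurrences_clique_graph:
  assumes "simple_graph G"
  shows "card (occurrences (clique_graph l) G) = card (cliques l G)"
proof -
  have "occurrences (clique_graph l) G = (\<lambda>K. (K, nsets K 2)) ` cliques l G"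
  proof (intro equalityI subsetI)
    fix H assume "H \<in> occurrences (clique_graph l) G"
    then have H: "simple_graph H" "verts H \<subseteq> verts G" "edges H \<subseteq> edges G" "isomorphic H (clique_graph l)"
      by (auto simp: occurrences_def subgraph_def)
    then have "verts H \<in> cliques l G" "H = (verts H, nsets (verts H) 2)"
      using isomorphic_clique_graph[OF H(1)]
      by (auto simp: cliques_def simple_graph_def prod_eq_iff) (auto simp: nsets_def)
    then show "H \<in> (\<lambda>K. (K, nsets K 2)) ` cliques l G" by blast
  next
    fix H assume "H \<in> (\<lambda>K. (K, nsets K 2)) ` cliques l G"
    then obtain K where K: "K \<in> cliques l G" "H = (K, nsets K 2)" by auto
    then have "simple_graph H" by (auto simp: simple_graph_def cliques_def nsets_def)
    moreover from this have "isomorphic H (clique_graph l)"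
      using K by (simp add: isomorphic_clique_graph cliques_def nsets_def)
    ultimately show "H \<in> occurrences (clique_graph l) G"
      using K by (auto simp: occurrences_def subgraph_def cliques_def nsets_def)
  qed
  then show ?thesis by (simp add: card_image inj_on_def)
qed

lemma simple_graph_range_subgraph: "simple_graph G \<Longrightarrow> simple_graph (range_subgraph G A x1 x2)"
  by (auto simp: simple_graph_def range_subgraph_def induced_def nsets_def)

lemma cliques_range_subgraph:
  "cliques l (range_subgraph G A x1 x2) = {K \<in> cliques l G. \<forall>v\<in>K. x1 \<le> A v \<and> A v \<le> x2}"
  by (auto simp: cliques_def range_subgraph_def induced_def nsets_def) 

lemma finite_cliques: "simple_graph G \<Longrightarrow> finite (cliques l G)"
  unfolding cliques_def simple_graph_def
  by (auto intro: finite_subset[of _ "Pow (verts G)"] simp: nsets_def)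

lemma finite_edges: "simple_graph G \<Longrightarrow> finite (edges G)"
  unfolding simple_graph_def by (auto intro: finite_subset[of _ "Pow (verts G)"] simp: nsets_def)

text \<open>Every vertex of a clique is an endpoint of an edge: of one inside the clique if
  \<open>2 \<le> l\<close>, and by \<open>no_isolated\<close> if \<open>l = 1\<close>. There are at
  most \<open>2 * m\<close> endpoints. The bound lets counts fit into words of
  \<open>O(log m)\<close> bits.\<close>

lemma card_cliques_le:
  assumes G: "simple_graph G" and l: "1 \<le> l" "l = 1 \<longrightarrow> no_isolated G"
  shows "card (cliques l G) \<le> (2 * num_edges G) ^ l"
proof -
  have fin: "finite (\<Union>(edges G))"
    using G by (auto simp: simple_graph_def nsets_def intro: finite_subset[of _ "verts G"])
  have "card (\<Union>(edges G)) \<le> (\<Sum>e\<in>edges G. card e)"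
    by (rule card_Union_le_sum_card)
  also have "\<dots> = (\<Sum>e\<in>edges G. 2)"
    using G by (intro sum.cong) (auto simp: simple_graph_def nsets_def)
  finally have card: "card (\<Union>(edges G)) \<le> 2 * num_edges G" by (simp add: num_edges_def)
  have "cliques l G \<subseteq> nsets (\<Union>(edges G)) l"
  proof
    fix K assume K: "K \<in> cliques l G"
    have "v \<in> \<Union>(edges G)" if v: "v \<in> K" for v
    proof (cases "l = 1")
      case True
      then show ?thesis using l K v by (auto simp: no_isolated_def cliques_def nsets_def)
    next
      case False
      then have "K \<noteq> {v}" using K l by (auto simp: cliques_def nsets_def)
      then obtain v' where "v' \<in> K" "v' \<noteq> v" using v by auto
      then have "{v, v'} \<in> nsets K 2" using v by (auto simp: nsets_def)
      moreover have "nsets K 2 \<subseteq> edges G" using K by (simp add: cliques_def)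
      ultimately show ?thesis by blast
    qed
    then show "K \<in> nsets (\<Union>(edges G)) l" using K by (auto simp: cliques_def nsets_def)
  qed
  then have "card (cliques l G) \<le> card (\<Union>(edges G)) choose l"
    using fin card_mono[of "nsets (\<Union>(edges G)) l"] by (simp add: card_nsets finite_imp_finite_nsets)
  also have "\<dots> \<le> card (\<Union>(edges G)) ^ l"
    by (cases "l \<le> card (\<Union>(edges G))") (simp_all add: binomial_le_pow binomial_eq_0)
  also have "\<dots> \<le> (2 * num_edges G) ^ l"
    using card by (rule power_mono) simp
  finally show ?thesis .
qed

section \<open>Attribute intervals of cliques\<close>

definition attr_span :: "('a \<Rightarrow> real) \<Rightarrow> 'a set \<Rightarrow> real \<times> real" where
  "attr_span A K = (Min (A ` K), Max (A ` K))"

lemma attr_span_within: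
  assumes "finite K" "K \<noteq> {}"
  shows "(\<forall>v\<in>K. x1 \<le> A v \<and> A v \<le> x2) \<longleftrightarrow> x1 \<le> fst (attr_span A K) \<and> snd (attr_span A K) \<le> x2"
  using assms by (auto simp: attr_span_def)

text \<open>A vertex of least and a vertex of greatest attribute are adjacent in a clique, and their
  edge spans the same interval.\<close>

lemma attr_span_edge:
  assumes K: "K \<in> cliques l G" and l: "2 \<le> l"
  shows "\<exists>e\<in>edges G. attr_span A e = attr_span A K"
proof -
  have fin: "finite K" "card K = l" using K by (auto simp: cliques_def nsets_def)
  then have ne: "A ` K \<noteq> {}" using l by auto
  obtain u where u: "u \<in> K" "A u = Min (A ` K)" using Min_in[OF _ ne] fin by auto
  obtain v where v: "v \<in> K" "A v = Max (A ` K)" using Max_in[OF _ ne] fin by auto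
  \<comment> \<open>If one vertex attains both extremes, all attributes in \<open>K\<close> coincide
    and any other vertex can serve as second endpoint.\<close>
  obtain v' where v': "v' \<in> K" "A v' = Max (A ` K)" "v' \<noteq> u"
  proof (cases "u = v")
    case True
    have "K \<noteq> {u}" using fin l by auto
    then obtain y where y: "y \<in> K" "y \<noteq> u" using u by auto
    have "Min (A ` K) \<le> A y" "A y \<le> Max (A ` K)" using y fin by auto
    then have "A y = Max (A ` K)" using u v True by simp
    then show ?thesis using that y by blast
  next
    case False
    then show ?thesis using that v by blast
  qed
  have "{u, v'} \<in> nsets K 2" using u v' by (auto simp: nsets_def)
  then have "{u, v'} \<in> edges G" using K by (auto simp: cliques_def)
  moreover have "A u \<le> A v'" unfolding u(2) using v'(1) fin(1) by simp
  then have "attr_span A {u, v'} = attr_span A K"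
    using u(2) v'(2) by (simp add: attr_span_def)
  ultimately show ?thesis by blast
qed

lemma card_attr_spans_le:
  assumes G: "simple_graph G" and l: "1 \<le> l" "l = 1 \<longrightarrow> no_isolated G"
  shows "card (attr_span A ` cliques l G) \<le> 2 * num_edges G"
proof (cases "l = 1")
  case True
  have "card (attr_span A ` cliques l G) \<le> card (cliques l G)"
    by (rule card_image_le) (rule finite_cliques[OF G])
  then show ?thesis using card_cliques_le[OF assms] True by simp
next
  case False
  then have "2 \<le> l" using l by simp
  then have "attr_span A ` cliques l G \<subseteq> attr_span A ` edges G"
    using attr_span_edge by (metis image_subsetI image_eqI)
  then have "card (attr_span A ` cliques l G) \<le> card (edges G)"
    using finite_edges[OF G] by (meson card_image_le card_mono finite_imageI order_trans)
  then show ?thesis by (simp add: num_edges_def)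
qed

lemma sum_fibre_cards:
  assumes "finite S"
  shows "(\<Sum>y\<in>g ` S. if P y then card {x \<in> S. g x = y} else 0) = card {x \<in> S. P (g x)}"
proof -
  have "card {x \<in> S. P (g x)} = (\<Sum>x\<in>S. if P (g x) then 1 else 0)"
    using assms by (simp add: sum.If_cases Int_def)
  also have "\<dots> = (\<Sum>y\<in>g ` S. \<Sum>x\<in>{x \<in> S. g x = y}. if P (g x) then 1 else 0)"
    using assms by (rule sum.image_gen)
  also have "\<dots> = (\<Sum>y\<in>g ` S. if P y then card {x \<in> S. g x = y} else 0)"
    by (intro sum.cong) auto
  finally show ?thesis by simp
qed

section \<open>Number of levels, word length and asymptotic bounds\<close>

lemma ex_two_power_between: "\<exists>H>0. d < 2 ^ H \<and> 2 ^ H \<le> 2 * d + (2::nat)"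
proof (induction d)
  case 0
  show ?case by (rule exI[of _ 1]) simp
next
  case (Suc d)
  then obtain H where H: "0 < H" "d < 2 ^ H" "2 ^ H \<le> 2 * d + (2::nat)" by blast
  show ?case
  proof (cases "Suc d < 2 ^ H")
    case True
    with H show ?thesis by auto
  next
    case False
    with H show ?thesis by (intro exI[of _ "Suc H"]) auto
  qed
qed

lemma two_power_ge_of_log:
  assumes "real c * log 2 (real m + 2) \<le> real w"
  shows "(m + 2) ^ c \<le> 2 ^ w"
proof -
  have "real ((m + 2) ^ c) = (real m + 2) powr real c"
    by (simp add: powr_realpow add.commute)
  also have "\<dots> = (2 powr log 2 (real m + 2)) powr real c"
    by simp
  also have "\<dots> = 2 powr (real c * log 2 (real m + 2))"
    by (simp only: powr_powr mult.commute)
  also have "\<dots> \<le> 2 powr real w"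
    using assms by (intro powr_mono) auto
  also have "\<dots> = real (2 ^ w)"
    by (simp add: powr_realpow)
  finally show ?thesis by (simp only: of_nat_le_iff)
qed

text \<open>From \<open>m = 2\<close> on, \<open>4 * m + 2 \<le> m ^ 4\<close>. This bounds the
  logarithm by four times that of \<open>m\<close>, and the added 1 costs a fifth.\<close>

lemma query_time_bigo: "(\<lambda>m. 5000 * (log 2 (4 * real m + 2) + 1) ^ 4) \<in> O(\<lambda>m. ln (real m) ^ 4)"
proof (rule bigoI)
  have "5000 * (log 2 (4 * real m + 2) + 1) ^ 4 \<le> 5000 * (5 / ln 2) ^ 4 * ln (real m) ^ 4 \<and>
      0 \<le> log 2 (4 * real m + 2)" if m: "2 \<le> m" for m
  proof -
    have "8 * real m \<le> real m ^ 3 * real m"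
      by (rule mult_right_mono) (use power_mono[of 2 "real m" 3] m in simp_all)
    moreover have "real m ^ 3 * real m = real m ^ 4"
      by (simp add: power3_eq_cube power4_eq_xxxx)
    ultimately have "4 * real m + 2 \<le> real m ^ 4"
      using m by linarith
    then have "ln (4 * real m + 2) \<le> ln (real m ^ 4)"
      using m by (subst ln_le_cancel_iff) auto
    also have "\<dots> = 4 * ln (real m)"
      using m by (simp add: ln_realpow)
    finally have "ln (4 * real m + 2) \<le> 4 * ln (real m)" .
    moreover have "ln 2 \<le> ln (real m)" using m by simp
    ultimately have "ln (4 * real m + 2) + ln 2 \<le> 5 * ln (real m)" by linarith
    then have "(ln (4 * real m + 2) + ln 2) / ln 2 \<le> 5 * ln (real m) / ln 2"
      by (rule divide_right_mono) simp
    then have "log 2 (4 * real m + 2) + 1 \<le> 5 / ln 2 * ln (real m)"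
      by (simp add: log_def add_divide_distrib)
    moreover have "0 \<le> log 2 (4 * real m + 2)" by simp
    ultimately have "(log 2 (4 * real m + 2) + 1) ^ 4 \<le> (5 / ln 2 * ln (real m)) ^ 4"
      by (intro power_mono) auto
    then show ?thesis by (simp add: power_mult_distrib power_divide)
  qed
  then show "\<forall>\<^sub>F m in sequentially. norm (5000 * (log 2 (4 * real m + 2) + 1) ^ 4)
      \<le> 5000 * (5 / ln 2) ^ 4 * norm (ln (real m) ^ 4)"
    by (intro eventually_sequentiallyI[of 2]) simp
qed

lemma space_bigo: "(\<lambda>m. 14 * (4 * real m + 2)) \<in> O(\<lambda>m. real m)"
proof (rule bigoI)
  show "\<forall>\<^sub>F m in sequentially. norm (14 * (4 * real m + 2)) \<le> 84 * norm (real m)"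
    by (intro eventually_sequentiallyI[of 1]) simp
qed

text \<open>The same \<open>query_prog\<close> serves every \<open>l\<close>; the pattern enters
  only through the stored points and weights and the constant in the word length.\<close>

theorem theorem3:
  fixes l :: nat
  assumes "1 \<le> l"
  shows "\<exists>(p :: com) (c :: nat) (k :: nat) (S :: nat \<Rightarrow> real) (T :: nat \<Rightarrow> real).
    S \<in> O(\<lambda>m. real m) \<and> T \<in> O(\<lambda>m. ln (real m) ^ k) \<and>
    (\<forall>(G :: 'a graph) (A :: 'a \<Rightarrow> real) (w :: nat).
      simple_graph G \<and> (l = 1 \<longrightarrow> no_isolated G) \<and>
      real c * log 2 (real (num_edges G) + 2) \<le> real w \<longrightarrow>
      (\<exists>D. valid_image w D \<and> real (space D) \<le> S (num_edges G) \<and>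
        (\<forall>x1 x2. x1 \<le> x2 \<longrightarrow>
          (\<exists>t. real t \<le> T (num_edges G) \<and>
            answers w D p x1 x2 t
              (card (occurrences (clique_graph l) (range_subgraph G A x1 x2)))))))"
proof -
  \<comment> \<open>\<open>S\<close> and \<open>T\<close> are the bounds of
    \<open>dominance_sum\<close> with \<open>2 ^ H \<le> 4 * m + 2\<close> inserted.\<close>
  define S :: "nat \<Rightarrow> real" where "S m = 14 * (4 * real m + 2)" for m
  define T :: "nat \<Rightarrow> real" where "T m = 5000 * (log 2 (4 * real m + 2) + 1) ^ 4" for m
  have "\<exists>D. valid_image w D \<and> real (space D) \<le> S (num_edges G) \<and>
      (\<forall>x1 x2. x1 \<le> x2 \<longrightarrow> (\<exists>t. real t \<le> T (num_edges G) \<and>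
        answers w D query_prog x1 x2 t (card (occurrences (clique_graph l) (range_subgraph G A x1 x2)))))"
    if G: "simple_graph G" "l = 1 \<longrightarrow> no_isolated G"
      and w: "real (2 * l + 8) * log 2 (real (num_edges G) + 2) \<le> real w"
    for G :: "'a graph" and A :: "'a \<Rightarrow> real" and w :: nat
  proof -
    define m where "m = num_edges G"
    define C where "C = cliques l G"
    define X where "X = attr_span A ` C"
    have fin: "finite C" unfolding C_def by (rule finite_cliques[OF G(1)])
    have card_X: "card X \<le> 2 * m" 
      unfolding X_def C_def m_def by (rule card_attr_spans_le[OF G(1) assms G(2)])
    have card_C: "card C \<le> (2 * m) ^ l"
      unfolding C_def m_def by (rule card_cliques_le[OF G(1) assms G(2)])
    \<comment> \<open>\<open>2 * m < 2 ^ H\<close> makes room for all distinct intervals among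
      \<open>2 ^ H - 1\<close> points, while \<open>2 ^ H\<close> stays linear in
      \<open>m\<close>.\<close>
    obtain H where H: "0 < H" "2 * m < 2 ^ H" "2 ^ H \<le> 4 * m + 2"
      using ex_two_power_between[of "2 * m"] by auto
    \<comment> \<open>In the exponent, \<open>2 * l\<close> covers the number of cliques, since
      \<open>2 * m \<le> (m + 2) ^ 2\<close>; the 8 covers addresses and constant factors, which
      powers of \<open>m + 2\<close> absorb because it is at least 2.\<close>
    have pow_w: "(m + 2) ^ (2 * l + 8) \<le> 2 ^ w"
      unfolding m_def by (rule two_power_ge_of_log[OF w])
    have address: "6 * (2 ^ H + H + 1) < (2::nat) ^ w"
    proof -
      have "6 * (N + H + 1) \<le> 12 * N" if "H < N" for N :: nat
        using that by simp
      from this[OF less_exp] have "6 * (2 ^ H + H + 1) \<le> 12 * (2::nat) ^ H" .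
      also have "\<dots> < 2 ^ 6 * (m + 2) ^ 1" using H(3) by simp
      also have "\<dots> \<le> (m + 2) ^ 6 * (m + 2) ^ 1" by (intro mult_right_mono power_mono) auto
      also have "\<dots> = (m + 2) ^ (6 + 1)" by (rule power_add[symmetric])
      also have "\<dots> \<le> (m + 2) ^ (2 * l + 8)" by (rule power_increasing) auto
      finally show ?thesis using pow_w by (rule less_le_trans)
    qed
    have weight: "2 * card C < 2 ^ w"
    proof -
      have "2 * m \<le> (m + 2) ^ 2" by (simp add: power2_eq_square)
      then have "(2 * m) ^ l \<le> ((m + 2) ^ 2) ^ l" by (rule power_mono) simp
      then have "2 * card C \<le> 2 * (m + 2) ^ (2 * l)" using card_C by (simp add: power_mult)
      also have "\<dots> < 2 ^ 8 * (m + 2) ^ (2 * l)" by simp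
      also have "\<dots> \<le> (m + 2) ^ 8 * (m + 2) ^ (2 * l)" by (intro mult_right_mono power_mono) auto
      also have "\<dots> = (m + 2) ^ (2 * l + 8)" by (simp add: power_add)
      finally show ?thesis using pow_w by (rule less_le_trans)
    qed
    obtain xs where xs: "set xs = X" "distinct xs"
      using finite_distinct_list[of X] fin by (auto simp: X_def)
    define wt where "wt x = card {K \<in> C. attr_span A K = x}" for x
    \<comment> \<open>Points of weight zero pad the list to the required length and leave every sum
      unchanged.\<close>
    define pts where "pts = map (\<lambda>x. (fst x, snd x, wt x)) xs @
      replicate (2 ^ H - 1 - length xs) (0, 0, 0)"
    have "length xs \<le> 2 ^ H - 1" using card_X H(2) xs by (metis distinct_card le_less_trans less_Suc_eq_le Suc_pred' zero_less_numeral zero_less_power)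
    then have len: "length pts = 2 ^ H - 1" by (simp add: pts_def)
    have sum: "(\<Sum>(a, b, c)\<leftarrow>pts. if P (a, b) then c else 0) = card {K \<in> C. P (attr_span A K)}" for P
    proof -
      have "(\<Sum>(a, b, c)\<leftarrow>pts. if P (a, b) then c else 0) = (\<Sum>x\<leftarrow>xs. if P x then wt x else 0)"
        by (simp add: pts_def o_def sum_list_replicate)
      also have "\<dots> = (\<Sum>x\<in>X. if P x then wt x else 0)"
        using xs by (simp add: sum_list_distinct_conv_sum_set)
      also have "\<dots> = card {K \<in> C. P (attr_span A K)}"
        unfolding X_def wt_def by (rule sum_fibre_cards[OF fin])
      finally show ?thesis .
    qed
    have "2 * (\<Sum>(a, b, c)\<leftarrow>pts. c) < 2 ^ w"
      using sum[of "\<lambda>_. True"] weight by simp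
    from dominance_sum[OF H(1) len address this] obtain D where D: "valid_image w D" 
      "space D \<le> 14 * 2 ^ H"
      "\<And>x1 x2. \<exists>t\<le>5000 * (H + 1) ^ 4. answers w D query_prog x1 x2 t
        (\<Sum>(a, b, c)\<leftarrow>pts. if x1 \<le> a \<and> b \<le> x2 then c else 0)"
      by blast
    have count: "(\<Sum>(a, b, c)\<leftarrow>pts. if x1 \<le> a \<and> b \<le> x2 then c else 0) =
        card (occurrences (clique_graph l) (range_subgraph G A x1 x2))" for x1 x2
    proof -
      \<comment> \<open>Here \<open>1 \<le> l\<close> enters: the extremes of the attributes are
        meaningful only on nonempty sets.\<close>
      have "finite K \<and> K \<noteq> {}" if "K \<in> C" for K
        using that assms by (auto simp: C_def cliques_def nsets_def)
      then have "{K \<in> C. \<forall>v\<in>K. x1 \<le> A v \<and> A v \<le> x2} =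
          {K \<in> C. x1 \<le> fst (attr_span A K) \<and> snd (attr_span A K) \<le> x2}"
        using attr_span_within by blast
      then show ?thesis
        using sum[of "\<lambda>x. x1 \<le> fst x \<and> snd x \<le> x2"]
        by (simp add: card_occurrences_clique_graph simple_graph_range_subgraph[OF G(1)]
            cliques_range_subgraph C_def)
    qed
    have time: "real t \<le> T m" if "t \<le> 5000 * (H + 1) ^ 4" for t
    proof -
      have "real H = log 2 (real (2 ^ H))" by simp
      also have "\<dots> \<le> log 2 (4 * real m + 2)"
        using H(3) by (subst log_le_cancel_iff) (auto simp flip: of_nat_le_iff[where 'a = real])
      finally have "(real H + 1) ^ 4 \<le> (log 2 (4 * real m + 2) + 1) ^ 4"
        by (intro power_mono) auto
      moreover have "real t \<le> 5000 * (real H + 1) ^ 4"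
        using that by (simp flip: of_nat_le_iff[where 'a = real] add: add.commute)
      ultimately show ?thesis unfolding T_def by linarith
    qed
    have "space D \<le> 14 * (4 * m + 2)"
      using D(2) mult_le_mono2[OF H(3)] by (rule order_trans)
    then have "real (space D) \<le> real (14 * (4 * m + 2))"
      by (rule of_nat_mono)
    then have "real (space D) \<le> S m"
      by (simp add: S_def)
    then show ?thesis
      using D(1,3) time unfolding count m_def by blast
  qed
  moreover have "S \<in> O(\<lambda>m. real m)" "T \<in> O(\<lambda>m. ln (real m) ^ 4)"
    unfolding S_def T_def by (rule space_bigo, rule query_time_bigo)
  ultimately show ?thesis by blast
qed

end
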